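(* Let $1\le m\le n$, let $M$ be a constant symmetric positive definite real $n\times n$ matrix, $S$ a constant symmetric real $n\times n$ matrix, and $G$ a constant real $n\times m$ matrix of rank $m$. Consider the linear controlled Hamiltonian system $$(\Sigma)\qquad \dot q = M^{-1}p,\qquad \dot p = -Sq + Gu,$$ with $q,p\in\mathbb R^n$ and control $u\in\mathbb R^m$. Then $(\Sigma)$ can be transformed, by a feedback law $u=u(q,p)$, to the form $$(\widehat\Sigma)\qquad \dot q = M^{-1}p,\qquad \dot p = -\widehat M M^{-1}\widehat S\, q - G K_{\rm d} G^T\widehat M^{-1}p$$ for some symmetric positive definite $n\times n$ matrices $\widehat M=\widehat M^T\succ 0$ and $\widehat S=\widehat S^T\succ 0$ and some symmetric positive definite $m\times m$ matrix $K_{\rm d}=K_{\rm d}^T\succ0$, if and only if $(\Sigma)$ is controllable or its uncontrollable part is oscillatory. Moreover, the closed-loop system $(\widehat\Sigma)$ (obtained by any such transformation) is exponentially stable if and only if the original system $(\Sigma)$ is controllable.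
   Context: The system $(\Sigma)$ is the controlled Hamiltonian system with Hamiltonian $H(q,p)=\frac12 p^TM^{-1}p+\frac12 q^TSq$; the form $(\widehat\Sigma)$ has Hamiltonian $\widehat H(q,p)=\frac12p^T\widehat M^{-1}p+\frac12q^T\widehat Sq$. "Transformed by feedback" means that substituting $u=u(q,p)$ into $(\Sigma)$ gives exactly the vector field of $(\widehat\Sigma)$. Controllability is the usual (Kalman) controllability of the linear control system with state $(q,p)\in\mathbb R^{2n}$. The uncontrollable part of a linear control system $\dot x=Ax+Bu$ is the autonomous linear dynamics induced by $A$ on the quotient of the state space by the controllable subspace (the uncontrollable block in the Kalman decomposition). A linear dynamics $\dot x=Ax$ is called oscillatory if $A$ is diagonalizable (over $\mathbb C$) and each eigenvalue of $A$ is a nonzero purely imaginary number. $\succ0$ means positive definite. *)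

theory Defs
  imports "HOL-Analysis.Analysis" "Jordan_Normal_Form.Char_Poly"
begin

definition pos_def :: "real^'k^'k \<Rightarrow> bool" where
  "pos_def A \<longleftrightarrow> transpose A = A \<and> (\<forall>x. x \<noteq> 0 \<longrightarrow> inner x (A *v x) > 0)"

text \<open>Linear control systems \<open>x' = A x + B u\<close> on a Euclidean space. The controllable
  subspace is the column space of the Kalman matrix \<open>[B, A B, \<dots>, A^(N-1) B]\<close>, where \<open>N\<close> is the
  dimension of the state space.\<close>

definition controllable_subspace ::
    "('a::euclidean_space \<Rightarrow> 'a) \<Rightarrow> ('b \<Rightarrow> 'a) \<Rightarrow> 'a set" where
  "controllable_subspace A B = span (\<Union>k<DIM('a). range (\<lambda>u. (A ^^ k) (B u)))"

definition controllable ::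
    "('a::euclidean_space \<Rightarrow> 'a) \<Rightarrow> ('b \<Rightarrow> 'a) \<Rightarrow> bool" where
  "controllable A B \<longleftrightarrow> dim (controllable_subspace A B) = DIM('a)"

text \<open>The cosets of \<open>b 0, \<dots>, b (r-1)\<close> form a basis of the quotient of the whole space
  by the subspace \<open>W\<close>.\<close>

definition quotient_basis ::
    "'a::real_vector set \<Rightarrow> nat \<Rightarrow> (nat \<Rightarrow> 'a) \<Rightarrow> bool" where
  "quotient_basis W r b \<longleftrightarrow>
     (\<forall>c. (\<Sum>i<r. c i *\<^sub>R b i) \<in> W \<longrightarrow> (\<forall>i<r. c i = 0)) \<and>
     (\<forall>x. \<exists>c. x - (\<Sum>i<r. c i *\<^sub>R b i) \<in> W)"

text \<open>For an \<open>A\<close>-invariant subspace \<open>W\<close>, \<open>C\<close> is the matrix, in some basis, of the linear map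
  that \<open>A\<close> induces on the quotient by \<open>W\<close>. Such a \<open>C\<close> is unique up to similarity;
  if \<open>W\<close> is the whole space, it is the matrix with no rows.\<close>

definition quotient_map_matrix ::
    "('a::real_vector \<Rightarrow> 'a) \<Rightarrow> 'a set \<Rightarrow> real mat \<Rightarrow> bool" where
  "quotient_map_matrix A W C \<longleftrightarrow>
     (\<exists>r b. C \<in> carrier_mat r r \<and> quotient_basis W r b \<and>
        (\<forall>j<r. A (b j) - (\<Sum>i<r. (C $$ (i, j)) *\<^sub>R b i) \<in> W))"

definition uncontrollable_part ::
    "('a::euclidean_space \<Rightarrow> 'a) \<Rightarrow> ('b \<Rightarrow> 'a) \<Rightarrow> real mat \<Rightarrow> bool" where
  "uncontrollable_part A B C \<longleftrightarrow> quotient_map_matrix A (controllable_subspace A B) C"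

definition diagonalizable :: "complex mat \<Rightarrow> bool" where
  "diagonalizable A \<longleftrightarrow> (\<exists>D. similar_mat A D \<and> diagonal_mat D)"

definition oscillatory :: "real mat \<Rightarrow> bool" where
  "oscillatory A \<longleftrightarrow>
     diagonalizable (map_mat complex_of_real A) \<and>
     (\<forall>z. eigenvalue (map_mat complex_of_real A) z \<longrightarrow> z \<noteq> 0 \<and> Re z = 0)"

text \<open>Exponential stability of the origin in its global form; for the linear vector
  fields to which it is applied, this coincides with the local form.\<close>

definition solves_ode :: "('a::real_normed_vector \<Rightarrow> 'a) \<Rightarrow> (real \<Rightarrow> 'a) \<Rightarrow> bool" where
  "solves_ode f x \<longleftrightarrow> (\<forall>t\<ge>0. (x has_vector_derivative f (x t)) (at t within {0..}))"

definition exponentially_stable :: "('a::real_normed_vector \<Rightarrow> 'a) \<Rightarrow> bool" where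
  "exponentially_stable f \<longleftrightarrow>
     (\<exists>c>0. \<exists>a>0. \<forall>x. solves_ode f x \<longrightarrow>
        (\<forall>t\<ge>0. norm (x t) \<le> c * exp (- a * t) * norm (x 0)))"

text \<open>States are pairs \<open>(q, p)\<close>.\<close>

definition drift ::
    "real^'n^'n \<Rightarrow> real^'n^'n \<Rightarrow> (real^'n) \<times> (real^'n) \<Rightarrow> (real^'n) \<times> (real^'n)" where
  "drift M S = (\<lambda>(q, p). (matrix_inv M *v p, - (S *v q)))"

definition input_map :: "real^'m^'n \<Rightarrow> real^'m \<Rightarrow> (real^'n) \<times> (real^'n)" where
  "input_map G = (\<lambda>u. (0, G *v u))"

definition target_field ::
    "real^'n^'n \<Rightarrow> real^'m^'n \<Rightarrow> real^'n^'n \<Rightarrow> real^'n^'n \<Rightarrow> real^'m^'m \<Rightarrow>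
     (real^'n) \<times> (real^'n) \<Rightarrow> (real^'n) \<times> (real^'n)" where
  "target_field M G Mh Sh Kd = (\<lambda>(q, p).
     (matrix_inv M *v p,
      - ((Mh ** matrix_inv M ** Sh) *v q)
      - (G ** Kd ** transpose G ** matrix_inv Mh) *v p))"

definition feedback_transforms ::
    "real^'n^'n \<Rightarrow> real^'n^'n \<Rightarrow> real^'m^'n \<Rightarrow> ((real^'n) \<times> (real^'n) \<Rightarrow> real^'m) \<Rightarrow>
     ((real^'n) \<times> (real^'n) \<Rightarrow> (real^'n) \<times> (real^'n)) \<Rightarrow> bool" where
  "feedback_transforms M S G u f \<longleftrightarrow> (\<forall>x. drift M S x + input_map G (u x) = f x)"

end

theory Submission
  imports Defs
begin

text \<open>
  Put \<open>T = M\<inverse> S\<close> and \<open>B = M\<inverse> G\<close>. The map \<open>T\<close> is self-adjoint for the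
  inner product of \<open>M\<close>, so the controllable subspace \<open>W\<close> of \<open>(T, B)\<close> has the \<open>T\<close>-invariant
  \<open>M\<close>-orthogonal complement \<open>Z\<close>, on which \<open>T\<close> is diagonalizable with real eigenvalues. The
  controllable subspace of the full system is \<open>W \<times> M W\<close>, so the uncontrollable part is
  \<open>z'' = - T z\<close> on \<open>Z\<close>. It is oscillatory precisely when all eigenvalues of \<open>T\<close> on \<open>Z\<close>
  are positive, that is, when the potential energy is positive definite on \<open>Z\<close> (\<open>positive_modes\<close>);
  controllability is the case \<open>Z = 0\<close>.

  A feedback to the target form exists if and only if \<open>S + G F = Mh M\<inverse> Sh\<close> for some \<open>F\<close> (\<open>matching\<close>), that is, if
  and only if \<open>T + B F\<close> is a product of two positive definite maps for some \<open>F\<close>. Such a product is a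
  diagonalizable map with positive eigenvalues. Since \<open>F\<close> has no effect on the modes in \<open>Z\<close>, those must
  have positive eigenvalues (\<open>matching_imp_positive_modes\<close>). Conversely, on \<open>W\<close> the feedback can
  produce a basis of eigenvectors with positive eigenvalues. The vectors that can become
  eigenvectors for \<open>s\<close> are the solutions \<open>v\<close> of \<open>(T - s) v = B w\<close>, and
  \<open>controllable_subspace_resolvent\<close> shows that, for \<open>s > 0\<close>, they span at least \<open>W\<close>
  (\<open>positive_modes_imp_matching\<close>).

  For stability, the target Hamiltonian is an energy that is dissipated through the output
  \<open>G\<^sup>T Mh\<inverse> p\<close>. If the system is not controllable, an undamped mode in \<open>Z\<close> survives in every such
  closed loop and yields a periodic orbit (\<open>exponentially_stable_imp_controllable\<close>). If it is controllable, this
  output is observable, and the resolvent lemma, applied to the dual system, supplies a correction that turns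
  the energy into a strict Lyapunov function (\<open>observable_Lyapunov_imp_exponentially_stable\<close>).
\<close>

section \<open>Controllable subspaces\<close>

lemma subspace_controllable_subspace: "subspace (controllable_subspace A B)"
  by (simp add: controllable_subspace_def)

lemma input_in_controllable_subspace:
  fixes A :: "'a::euclidean_space \<Rightarrow> 'a"
  shows "B u \<in> controllable_subspace A B"
  unfolding controllable_subspace_def
  by (rule span_base, rule UN_I[of 0]) simp_all

lemma funpow_in_invariant:
  assumes "\<And>x. x \<in> U \<Longrightarrow> A x \<in> U" and "x \<in> U"
  shows "(A ^^ k) x \<in> U"
  using assms by (induction k) auto

text \<open>With the next lemma: the controllable subspace is the least \<open>A\<close>-invariant subspace that contains
  the range of \<open>B\<close>. Later proofs use only this characterization and never the powers of \<open>A\<close>.\<close>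

lemma controllable_subspace_least:
  assumes "subspace U" and "\<And>u. B u \<in> U" and "\<And>x. x \<in> U \<Longrightarrow> A x \<in> U"
  shows "controllable_subspace A B \<subseteq> U"
  unfolding controllable_subspace_def
  by (intro span_minimal assms) (use funpow_in_invariant[of U A] assms in blast)

text \<open>The subspaces spanned by the first \<open>j\<close> blocks \<open>B, A B, \<dots>\<close> increase with \<open>j\<close>, so for
  dimension reasons two consecutive ones coincide at some \<open>j \<le> DIM('a)\<close>. That one is already
  invariant, hence contains all further blocks. This replaces an appeal to Cayley-Hamilton.\<close>

lemma controllable_subspace_invariant:
  fixes A :: "'a::euclidean_space \<Rightarrow> 'a"
  assumes A: "linear A" and x: "x \<in> controllable_subspace A B"
  shows "A x \<in> controllable_subspace A B"
proof -
  define K where "K j = span (\<Union>k<j. range (\<lambda>u. (A ^^ k) (B u)))" for j :: nat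
  have mono: "K i \<subseteq> K j" if "i \<le> j" for i j
    unfolding K_def by (intro span_mono UN_mono) (use that in auto)
  have step: "A y \<in> K (Suc j)" if "y \<in> K j" for y j
  proof -
    have "A y \<in> A ` K j" using that by blast
    also have "\<dots> = span (A ` (\<Union>k<j. range (\<lambda>u. (A ^^ k) (B u))))"
      unfolding K_def by (rule linear_span_image[OF A, symmetric])
    also have "\<dots> \<subseteq> K (Suc j)"
      unfolding K_def
    proof (rule span_mono, clarify)
      fix k u assume "k < j"
      then show "A ((A ^^ k) (B u)) \<in> (\<Union>k<Suc j. range (\<lambda>u. (A ^^ k) (B u)))"
        by (intro UN_I[of "Suc k"]) auto
    qed
    finally show ?thesis .
  qed
  have "\<exists>j\<le>DIM('a). K (Suc j) = K j"
  proof (rule ccontr)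
    assume no: "\<not> ?thesis"
    have "j \<le> Suc (DIM('a)) \<Longrightarrow> j \<le> dim (K j)" for j
    proof (induction j)
      case (Suc j)
      then have "K j \<subset> K (Suc j)" using no mono[of j "Suc j"] by auto
      then have "dim (K j) < dim (K (Suc j))"
        using dim_psubset[of "K j" "K (Suc j)"] by (simp only: K_def span_span)
      then show ?case using Suc by simp
    qed simp
    from this[of "Suc (DIM('a))"] show False
      using dim_subset_UNIV[of "K (Suc (DIM('a)))"] by simp
  qed
  then obtain j where j: "j \<le> DIM('a)" "K (Suc j) = K j" by blast
  have "x \<in> K (DIM('a))" using x by (simp add: controllable_subspace_def K_def)
  also have "K (DIM('a)) \<subseteq> K j"
  proof -
    have "(A ^^ k) (B u) \<in> K j" for k u
    proof (rule funpow_in_invariant)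
      show "A y \<in> K j" if "y \<in> K j" for y using step[OF that] j by simp
      have "B u \<in> K (Suc j)" unfolding K_def by (rule span_base, rule UN_I[of 0]) simp_all
      then show "B u \<in> K j" using j by simp
    qed
    then show ?thesis unfolding K_def[of "DIM('a)"] by (intro span_minimal) (auto simp: K_def)
  qed
  finally have "A x \<in> K j" using step j by auto
  then have "A x \<in> K (DIM('a))" using mono[OF j(1)] by blast
  then show ?thesis by (simp add: controllable_subspace_def K_def)
qed

lemma controllable_iff_UNIV: "controllable A B \<longleftrightarrow> controllable_subspace A B = UNIV"
  unfolding controllable_def dim_eq_full by (simp only: controllable_subspace_def span_span)

lemma subspace_limit:
  fixes U :: "'a::euclidean_space set"
  assumes "subspace U" and "\<And>n. x n \<in> U" and "x \<longlonglongrightarrow> y"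
  shows "y \<in> U"
  using closed_sequentially[OF closed_subspace[OF assms(1)]] assms(2,3) by blast

text \<open>The substitute for pole placement. A vector \<open>v\<close> with \<open>T v - s v = B w\<close> is an eigenvector of
  \<open>T - B F\<close> for the eigenvalue \<open>s\<close> as soon as \<open>F v = w\<close>; the lemma says that such vectors, with
  \<open>s > 0\<close>, span at least the controllable subspace. If they
  span the whole space, a basis chosen among them defines a feedback that makes the closed loop
  diagonalizable with positive eigenvalues. This needs neither a canonical form nor a reduction to a single input.

  The span \<open>U\<close> is \<open>T\<close>-invariant because \<open>T v = s v + B w\<close>, provided that it contains the
  range of \<open>B\<close>. It does, since \<open>s inverse (T - s) b\<close> is in \<open>U\<close> and tends to \<open>- b\<close> as
  \<open>s\<close> grows, and subspaces are closed.\<close>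

lemma controllable_subspace_resolvent:
  fixes T :: "'a::euclidean_space \<Rightarrow> 'a"
  assumes T: "linear T"
  shows "controllable_subspace T B \<subseteq> span {v. \<exists>s>0. \<exists>w. T v - s *\<^sub>R v = B w}"
    (is "_ \<subseteq> ?U")
proof (rule controllable_subspace_least)
  obtain K where K: "K > 0" "\<And>x. norm (T x) \<le> K * norm x"
    using linear_bounded_pos[OF T] by blast
  \<comment> \<open>Beyond the operator norm of \<open>T\<close> there are no eigenvalues, so \<open>T - s\<close> is onto.\<close>
  have solve: "\<exists>v. T v - s *\<^sub>R v = b" if "s > K" for s b
  proof -
    have lin: "linear (\<lambda>v. T v - s *\<^sub>R v)"
      by (intro linear_compose_sub T linear_scaleR)
    have "v = 0" if "T v - s *\<^sub>R v = 0" for v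
    proof (rule ccontr)
      assume "v \<noteq> 0"
      then have "K * norm v < s * norm v" using \<open>s > K\<close> by simp
      also have "\<dots> = norm (T v)" using that \<open>s > K\<close> K(1) by simp
      finally show False using K(2)[of v] by simp
    qed
    then have "inj (\<lambda>v. T v - s *\<^sub>R v)" by (simp add: linear_injective_0[OF lin])
    then have "surj (\<lambda>v. T v - s *\<^sub>R v)" by (rule linear_inj_imp_surj[OF lin])
    then have "b \<in> range (\<lambda>v. T v - s *\<^sub>R v)" by simp
    then show ?thesis by (elim rangeE) (rule exI, erule sym)
  qed
  show "subspace ?U" by simp
  show Bu: "B u \<in> ?U" for u
  proof -
    \<comment> \<open>A sequence of values above \<open>K\<close> that tends to infinity.\<close>
    define s where "s n = K + 1 + real n" for n
    have s: "s n > K" "s n > 0" for n using K(1) by (auto simp: s_def)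
    obtain v where v: "\<And>n. T (v n) - s n *\<^sub>R v n = B u" 
      using choice[of "\<lambda>n v. T v - s n *\<^sub>R v = B u"] solve[OF s(1)] by blast
    have bound: "norm (v n) \<le> norm (B u) / (1 + real n)" for n
    proof -
      have "s n * norm (v n) = norm (T (v n) - B u)"
      proof -
        have "T (v n) - B u = s n *\<^sub>R v n" using v[of n] by (simp add: algebra_simps)
        then show ?thesis using s(2)[of n] by simp
      qed
      also have "\<dots> \<le> K * norm (v n) + norm (B u)"
        using norm_triangle_ineq4[of "T (v n)" "B u"] K(2)[of "v n"] by linarith
      finally have "(1 + real n) * norm (v n) \<le> norm (B u)"
        by (simp add: s_def algebra_simps)
      then show ?thesis by (simp add: field_simps)
    qed
    have "(\<lambda>n. norm (B u) / (1 + real n)) \<longlonglongrightarrow> 0"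
      using tendsto_mult[OF tendsto_const[of "norm (B u)"] LIMSEQ_inverse_real_of_nat]
      by (simp add: divide_inverse add.commute)
    then have "v \<longlonglongrightarrow> 0"
      by (rule Lim_null_comparison[rotated]) (use bound in auto)
    then have "(\<lambda>n. T (v n)) \<longlonglongrightarrow> T 0"
      by (rule isCont_tendsto_compose[rotated])
        (use linear_continuous_at T in \<open>simp add: linear_conv_bounded_linear\<close>)
    then have "(\<lambda>n. T (v n) - B u) \<longlonglongrightarrow> T 0 - B u" by (intro tendsto_intros)
    then have "T 0 - B u \<in> ?U"
    proof (rule subspace_limit[rotated 2])
      show "T (v n) - B u \<in> ?U" for n
      proof -
        have "T (v n) - B u = s n *\<^sub>R v n" using v[of n] by (simp add: algebra_simps)
        also have "\<dots> \<in> ?U" by (intro span_scale span_base) (use v s in blast)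
        finally show ?thesis .
      qed
    qed simp
    then have "- B u \<in> ?U" by (simp add: linear_0[OF T])
    then show ?thesis using span_neg[of "- B u"] by simp
  qed
  show "T x \<in> ?U" if "x \<in> ?U" for x
  proof -
    have "T x \<in> T ` ?U" using that by blast
    also have "\<dots> = span (T ` {v. \<exists>s>0. \<exists>w. T v - s *\<^sub>R v = B w})"
      by (rule linear_span_image[OF T, symmetric])
    also have "\<dots> \<subseteq> ?U"
    proof (rule span_minimal)
      show "T ` {v. \<exists>s>0. \<exists>w. T v - s *\<^sub>R v = B w} \<subseteq> ?U"
      proof clarify
        fix v s w assume h: "(s::real) > 0" "T v - s *\<^sub>R v = B w"
        have "T v = s *\<^sub>R v + B w" using h(2) by (simp add: algebra_simps)
        moreover have "s *\<^sub>R v \<in> ?U" by (intro span_scale span_base) (use h in blast)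
        ultimately show "T v \<in> ?U" by (simp add: Bu span_add)
      qed
    qed simp
    finally show ?thesis .
  qed
qed

section \<open>Positive definite matrices and self-adjoint maps\<close>

lemma symmetric_inner:
  fixes A :: "real^'k^'k"
  assumes "transpose A = A"
  shows "inner x (A *v y) = inner (A *v x) y"
  by (simp add: assms flip: dot_lmul_matrix transpose_matrix_vector)

lemma pos_def_inner: "pos_def A \<Longrightarrow> inner x (A *v y) = inner (A *v x) y"
  by (simp add: pos_def_def symmetric_inner)

lemma pos_def_pos: "pos_def A \<Longrightarrow> x \<noteq> 0 \<Longrightarrow> 0 < inner x (A *v x)"
  by (simp add: pos_def_def)

lemma pos_def_nonneg: "pos_def A \<Longrightarrow> 0 \<le> inner x (A *v x)"
  by (cases "x = 0") (auto dest: pos_def_pos simp: less_imp_le)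

lemma pos_def_eq_0_iff: "pos_def A \<Longrightarrow> inner x (A *v x) = 0 \<longleftrightarrow> x = 0"
  by (metis inner_zero_left less_irrefl pos_def_pos)

lemma pos_def_invertible:
  assumes "pos_def A"
  shows "invertible A"
proof -
  have "x = 0" if "A *v x = 0" for x
    using that pos_def_eq_0_iff[OF assms, of x] by simp
  then show ?thesis
    by (simp add: invertible_left_inverse matrix_left_invertible_ker)
qed

lemma pos_def_inv_cancel [simp]:
  assumes "pos_def A"
  shows "A *v (matrix_inv A *v x) = x" and "matrix_inv A *v (A *v x) = x"
proof -
  have "A ** matrix_inv A = Finite_Cartesian_Product.mat 1
      \<and> matrix_inv A ** A = Finite_Cartesian_Product.mat 1"
    unfolding matrix_inv_def
    using pos_def_invertible[OF assms] unfolding invertible_def by (rule someI_ex)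
  then show "A *v (matrix_inv A *v x) = x" "matrix_inv A *v (A *v x) = x"
    by (simp_all add: matrix_vector_mul_assoc)
qed

lemma pos_def_matrix:
  fixes f :: "real^'k \<Rightarrow> real^'k"
  assumes f: "linear f" and sym: "\<And>x y. inner x (f y) = inner (f x) y"
    and pos: "\<And>x. x \<noteq> 0 \<Longrightarrow> 0 < inner x (f x)"
  shows "pos_def (matrix f)"
proof -
  have fx: "matrix f *v x = f x" for x
    by (rule matrix_works) (simp add: linear_matrix_vector_mul_eq f)
  have "inner x (transpose (matrix f) *v y) = inner x (matrix f *v y)" for x y
  proof -
    have "inner x (transpose (matrix f) *v y) = inner y (matrix f *v x)"
      by (subst inner_commute) (simp only: transpose_matrix_vector dot_lmul_matrix)
    also have "\<dots> = inner x (f y)"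
      by (simp only: fx sym[of y x] inner_commute[of x])
    finally show ?thesis by (simp only: fx)
  qed
  then have "transpose (matrix f) *v y = matrix f *v y" for y
    by (intro vector_eq_ldot[THEN iffD1]) simp
  then show ?thesis
    using pos by (simp add: pos_def_def matrix_eq fx)
qed

lemma pos_def_matrix_inv:
  assumes A: "pos_def A"
  shows "pos_def (matrix_inv A)"
proof -
  have "pos_def (matrix ((*v) (matrix_inv A)))"
  proof (rule pos_def_matrix)
    show "inner x (matrix_inv A *v y) = inner (matrix_inv A *v x) y" for x y
      using pos_def_inner[OF A, of "matrix_inv A *v x" "matrix_inv A *v y"]
      by (simp add: A)
    show "0 < inner x (matrix_inv A *v x)" if "x \<noteq> 0" for x
    proof -
      have "matrix_inv A *v x \<noteq> 0"
        using that pos_def_inv_cancel(1)[OF A, of x] by auto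
      from pos_def_pos[OF A this] show ?thesis by (simp add: A inner_commute)
    qed
  qed simp
  then show ?thesis by simp
qed

text \<open>The orthogonal complement of \<open>E\<close> for the inner product \<open>inner x (M *v y)\<close> that a positive
  definite \<open>M\<close> defines. For symmetric \<open>S\<close>, the map \<open>matrix_inv M ** S\<close> is
  self-adjoint for this inner product but in general not for the standard one.\<close>

definition weighted_complement :: "real^'n^'n \<Rightarrow> (real^'n) set \<Rightarrow> (real^'n) set" where
  "weighted_complement M E = {y. \<forall>e\<in>E. inner e (M *v y) = 0}"

lemma subspace_weighted_complement: "subspace (weighted_complement M E)"
  by (auto simp: weighted_complement_def subspace_def matrix_vector_right_distrib inner_add_right
      matrix_vector_mult_scaleR)

lemma weighted_complement_disjoint:
  assumes "pos_def M" and "x \<in> E" and "x \<in> weighted_complement M E"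
  shows "x = 0"
  using assms pos_def_eq_0_iff by (auto simp: weighted_complement_def)

text \<open>\<open>weighted_complement M E\<close> is the ordinary orthogonal complement of the image of \<open>E\<close> under
  \<open>M\<close>, so it has complementary dimension, and it meets \<open>E\<close> only in \<open>0\<close>.\<close>

lemma weighted_decomposition:
  fixes M :: "real^'n^'n"
  assumes M: "pos_def M" and E: "subspace E"
  obtains e y where "e \<in> E" and "y \<in> weighted_complement M E" and "x = e + y"
proof -
  let ?N = "weighted_complement M E"
  have "inj ((*v) M)"
    by (rule inj_on_inverseI[where g = "(*v) (matrix_inv M)"]) (simp add: M)
  then have "inj_on ((*v) M) (span E)" by (rule inj_on_subset) simp
  then have dimM: "dim ((*v) M ` E) = dim E" by (intro dim_image_eq) simp_all
  have N: "?N = {y \<in> UNIV. \<forall>x\<in>(*v) M ` E. real_inner_class.orthogonal x y}"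
    unfolding weighted_complement_def Linear_Algebra.orthogonal_def pos_def_inner[OF M] by blast
  have dimN: "dim ?N + dim E = dim (UNIV :: (real^'n) set)"
  proof -
    have "subspace ((*v) M ` E)"
      by (rule linear_subspace_image[OF matrix_vector_mul_linear E])
    from dim_subspace_orthogonal_to_vectors[OF this subspace_UNIV subset_UNIV]
    show ?thesis by (simp only: N dimM)
  qed
  have "x = 0" if "x \<in> E \<inter> ?N" for x
    using weighted_complement_disjoint[OF M, of x E] that by simp
  then have "E \<inter> ?N = {0}"
    using subspace_0[OF subspace_inter[OF E subspace_weighted_complement, of M E]] by auto
  then have "dim {e + y |e y. e \<in> E \<and> y \<in> ?N} = dim (UNIV :: (real^'n) set)"
    using dim_sums_Int[OF E subspace_weighted_complement, of M E] dimN by simp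
  then have "span {e + y |e y. e \<in> E \<and> y \<in> ?N} = UNIV"
    unfolding dim_UNIV by (rule dim_eq_full[THEN iffD1])
  then have "{e + y |e y. e \<in> E \<and> y \<in> ?N} = UNIV"
    using subspace_sums[OF E subspace_weighted_complement] by (simp only: span_eq_iff[symmetric])
  then show ?thesis using that by blast
qed

lemma quadratic_nonneg_imp_linear_0:
  fixes a b :: real
  assumes "\<And>t. 0 \<le> 2 * t * a + t\<^sup>2 * b"
  shows "a = 0"
proof (rule ccontr)
  assume "a \<noteq> 0"
  define c where "c = \<bar>b\<bar> + 1"
  have c: "c > 0" "b < 2 * c" by (auto simp: c_def)
  \<comment> \<open>The linear term dominates the quadratic one at \<open>t = - a / c\<close>.\<close>
  have "2 * (- a / c) * a + (- a / c)\<^sup>2 * b = (a / c)\<^sup>2 * (b - 2 * c)"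
    using c by (simp add: field_simps power2_eq_square)
  also have "\<dots> < 0" using c \<open>a \<noteq> 0\<close> by (intro mult_pos_neg) auto
  finally show False using assms[of "- a / c"] by simp
qed

text \<open>The Rayleigh quotient attains a minimum \<open>l\<close> on the unit sphere of \<open>Z\<close>, at \<open>z\<close> say. The form
  \<open>h x y = inner x (M *v T y) - l * inner x (M *v y)\<close> is then positive semidefinite on \<open>Z\<close> with
  \<open>h z z = 0\<close>, so \<open>h z y = 0\<close> for all \<open>y\<close> in \<open>Z\<close>; taking \<open>y = T z - l z\<close> makes \<open>z\<close> an
  eigenvector. The bound by \<open>l\<close> locates a nonpositive eigenvalue
  when the form of \<open>T\<close> fails to be positive.\<close>

lemma selfadjoint_least_eigenvector:
  fixes T :: "real^'n \<Rightarrow> real^'n"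
  assumes M: "pos_def M" and T: "linear T"
    and sa: "\<And>x y. inner (T x) (M *v y) = inner x (M *v T y)"
    and Z: "subspace Z" "\<And>z. z \<in> Z \<Longrightarrow> T z \<in> Z" and nz: "x0 \<in> Z" "x0 \<noteq> 0"
  obtains z l where "z \<in> Z" "z \<noteq> 0" "T z = l *\<^sub>R z"
    "\<forall>x\<in>Z. l * inner x (M *v x) \<le> inner x (M *v T x)"
proof -
  define g where "g x = inner x (M *v T x) / inner x (M *v x)" for x
  have contT: "continuous_on A T" for A
    using T by (simp add: linear_continuous_on linear_conv_bounded_linear)
  have contM: "continuous_on A ((*v) M)" for A
    by (simp add: linear_continuous_on)
  have cont: "continuous_on (Z \<inter> sphere 0 1) g"
    unfolding g_def
    by (intro continuous_intros continuous_on_compose2[OF contM[of UNIV]] contT)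
      (auto simp: pos_def_eq_0_iff[OF M])
  have "compact (Z \<inter> sphere 0 1)"
    by (simp add: closed_Int_compact closed_subspace[OF Z(1)])
  moreover have "x0 /\<^sub>R norm x0 \<in> Z \<inter> sphere 0 1"
    using nz by (auto intro: subspace_scale[OF Z(1)])
  ultimately obtain z where z: "z \<in> Z \<inter> sphere 0 1" and
    least: "\<And>x. x \<in> Z \<inter> sphere 0 1 \<Longrightarrow> g z \<le> g x"
    using continuous_attains_inf[OF _ _ cont] by blast
  define l where "l = g z"
  have z0: "z \<in> Z" "z \<noteq> 0" using z by auto
  have lower: "l * inner x (M *v x) \<le> inner x (M *v T x)" if "x \<in> Z" for x
  proof (cases "x = 0")
    case False
    have "l \<le> g (x /\<^sub>R norm x)"
      unfolding l_def using that False by (intro least) (auto intro: subspace_scale[OF Z(1)])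
    also have "\<dots> = g x"
      using False by (simp add: g_def linear_scale[OF T] matrix_vector_mult_scaleR)
    finally show ?thesis
      using pos_def_pos[OF M False] by (simp add: g_def field_simps)
  qed simp
  define h where "h x y = inner x (M *v T y) - l * inner x (M *v y)" for x y
  have hsym: "h x y = h y x" for x y
  proof -
    have sym: "inner a (M *v b) = inner b (M *v a)" for a b
      by (subst pos_def_inner[OF M]) (rule inner_commute)
    show ?thesis unfolding h_def using sa[of x y] sym[of "T x" y] sym[of x y] by simp
  qed
  have hzz: "h z z = 0"
    using pos_def_pos[OF M z0(2)] by (simp add: h_def l_def g_def)
  have hadd: "h x (a + b) = h x a + h x b" and hscale: "h x (t *\<^sub>R a) = t * h x a" for x a b t
    by (simp_all add: h_def linear_add[OF T] linear_scale[OF T] matrix_vector_right_distrib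
        inner_add_right matrix_vector_mult_scaleR distrib_left right_diff_distrib
        mult.left_commute)
  have hz: "h z y = 0" if "y \<in> Z" for y
  proof (rule quadratic_nonneg_imp_linear_0)
    fix t
    have "0 \<le> h (z + t *\<^sub>R y) (z + t *\<^sub>R y)"
      using lower[of "z + t *\<^sub>R y"] z0 that
      by (simp add: h_def subspace_add[OF Z(1)] subspace_scale[OF Z(1)])
    also have "\<dots> = h z z + 2 * t * h z y + t\<^sup>2 * h y y"
      unfolding hadd hscale hsym[of "z + t *\<^sub>R y"]
      by (simp add: hsym[of y z] power2_eq_square algebra_simps)
    finally show "0 \<le> 2 * t * h z y + t\<^sup>2 * h y y" using hzz by simp
  qed
  define d where "d = T z - l *\<^sub>R z"
  have "d \<in> Z"
    unfolding d_def by (intro subspace_diff[OF Z(1)] subspace_scale[OF Z(1)] Z(2) z0)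
  have "inner d (M *v d) = h d z"
    by (simp add: d_def[of ] h_def matrix_vector_mult_diff_distrib inner_diff_right
        matrix_vector_mult_scaleR)
  also have "\<dots> = 0" using hz[OF \<open>d \<in> Z\<close>] hsym by simp
  finally have "T z = l *\<^sub>R z"
    by (simp add: pos_def_eq_0_iff[OF M] d_def)
  with z0 lower that show ?thesis by blast
qed

text \<open>The part of \<open>Z\<close> that is orthogonal to all eigenvectors in \<open>Z\<close> is invariant; were it nonzero, it
  would contain an eigenvector by the previous lemma, and that eigenvector would be orthogonal to
  itself.\<close>

lemma selfadjoint_eigenvectors_span:
  fixes T :: "real^'n \<Rightarrow> real^'n"
  assumes M: "pos_def M" and T: "linear T"
    and sa: "\<And>x y. inner (T x) (M *v y) = inner x (M *v T y)"
    and Z: "subspace Z" "\<And>z. z \<in> Z \<Longrightarrow> T z \<in> Z"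
  shows "Z \<subseteq> span {z \<in> Z. \<exists>l. T z = l *\<^sub>R z}" (is "_ \<subseteq> span ?B")
proof
  fix x assume x: "x \<in> Z"
  let ?E = "span ?B"
  have EZ: "?E \<subseteq> Z" by (intro span_minimal Z) auto
  have TE: "T e \<in> ?E" if "e \<in> ?E" for e
  proof -
    have "T e \<in> span (T ` ?B)" using that linear_span_image[OF T, of ?B] by blast
    also have "\<dots> \<subseteq> ?E"
      by (rule span_minimal) (clarsimp, auto intro: span_scale span_base)
    finally show ?thesis .
  qed
  let ?Y = "Z \<inter> weighted_complement M ?E"
  have Y: "subspace ?Y"
    by (intro subspace_inter Z subspace_weighted_complement)
  have TY: "T y \<in> ?Y" if "y \<in> ?Y" for y
    using that Z(2) TE by (auto simp: weighted_complement_def sa[symmetric])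
  have Y0: "y = 0" if y: "y \<in> ?Y" for y
  proof (rule ccontr)
    assume "y \<noteq> 0"
    obtain z l where z: "z \<in> ?Y" "z \<noteq> 0" "T z = l *\<^sub>R z"
      by (rule selfadjoint_least_eigenvector[OF M T sa Y TY y \<open>y \<noteq> 0\<close>])
    then have "z \<in> ?E" by (intro span_base) auto
    with z show False using weighted_complement_disjoint[OF M] by blast
  qed
  obtain e y where ey: "e \<in> ?E" "y \<in> weighted_complement M ?E" "x = e + y"
    using weighted_decomposition[OF M, of ?E x] by auto
  have "x - e \<in> Z" using x ey(1) EZ by (intro subspace_diff[OF Z(1)]) auto
  then have "y = 0" using Y0[of y] ey by simp
  then show "x \<in> ?E" using ey by simp
qed

section \<open>Matching with a Hamiltonian target\<close>

text \<open>The form of \<open>P\<close> is the weighted sum of the squares \<open>(inner v x)\<^sup>2\<close>; it is definite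
  because \<open>V\<close> spans. With the eigenvectors of a closed loop as \<open>V\<close>, and \<open>1\<close> or
  their eigenvalues as weights, \<open>P\<close> provides the positive definite factors of the closed loop. It
  also serves as a Lyapunov function.\<close>

lemma weighted_gram:
  fixes V :: "'a::euclidean_space set" and c :: "'a \<Rightarrow> real"
  assumes V: "finite V" "span V = UNIV" and c: "\<And>v. v \<in> V \<Longrightarrow> 0 < c v"
  defines "P \<equiv> \<lambda>y. \<Sum>v\<in>V. (c v * inner v y) *\<^sub>R v"
  shows "linear P" and "inner x (P y) = inner (P x) y" and "x \<noteq> 0 \<Longrightarrow> 0 < inner x (P x)"
proof -
  show "linear P"
    unfolding P_def
    by (intro linear_compose_sum ballI linearI)
      (simp_all add: inner_add_right distrib_left scaleR_left_distrib mult.left_commute)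
  have form: "inner x (P y) = (\<Sum>v\<in>V. c v * (inner v x * inner v y))" for x y
    by (simp add: P_def inner_sum_right inner_commute[of x] mult_ac)
  show "inner x (P y) = inner (P x) y"
    unfolding inner_commute[of "P x" y] form by (simp add: mult.commute)
  show "0 < inner x (P x)" if "x \<noteq> 0"
  proof -
    have "\<exists>v\<in>V. inner v x \<noteq> 0"
    proof (rule ccontr)
      assume "\<not> ?thesis"
      then have "V \<subseteq> {v. inner v x = 0}" by blast
      moreover have "subspace {v. inner v x = 0}"
        by (auto simp: subspace_def inner_add_left)
      ultimately have "span V \<subseteq> {v. inner v x = 0}" by (rule span_minimal)
      then have "inner x x = 0" unfolding V(2) by blast
      with that show False by simp
    qed
    then obtain v where v: "v \<in> V" "inner v x \<noteq> 0" by blast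
    show ?thesis
      unfolding form
      by (rule sum_pos2[OF V(1) v(1)]) (use v c in \<open>auto simp: less_imp_le zero_less_mult_iff\<close>)
  qed
qed

lemma weighted_gram_pos_def:
  fixes V :: "(real^'n) set" and c :: "real^'n \<Rightarrow> real"
  assumes "finite V" "span V = UNIV" and "\<And>v. v \<in> V \<Longrightarrow> 0 < c v"
  shows "pos_def (matrix (\<lambda>y. \<Sum>v\<in>V. (c v * inner v y) *\<^sub>R v))"
  using assms by (intro pos_def_matrix weighted_gram)

text \<open>The system reads \<open>q'' = - T q + B u\<close>, where \<open>T\<close> and \<open>B\<close> are as
  below. The space \<open>W\<close> is the controllable subspace of the pair \<open>(T, B)\<close> on the configuration space,
  and \<open>Z\<close>, its complement for the inner product of \<open>M\<close>, carries the modes that no input can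
  reach.\<close>

locale hamiltonian_system =
  fixes M S :: "real^'n^'n" and G :: "real^'m^'n"
  assumes M: "pos_def M" and S: "transpose S = S"
begin

definition T :: "real^'n \<Rightarrow> real^'n" where
  "T q = matrix_inv M *v (S *v q)"

definition B :: "real^'m \<Rightarrow> real^'n" where
  "B w = matrix_inv M *v (G *v w)"

definition W :: "(real^'n) set" where
  "W = controllable_subspace T B"

definition Z :: "(real^'n) set" where
  "Z = weighted_complement M W"

text \<open>The condition to which both sides of the equivalence reduce: the potential energy is positive
  on the unreachable modes. For a controllable system it holds because \<open>Z\<close> is trivial.\<close>

definition positive_modes :: bool where
  "positive_modes \<longleftrightarrow> (\<forall>z\<in>Z. z \<noteq> 0 \<longrightarrow> 0 < inner z (S *v z))"

text \<open>The equation that remains of the feedback condition at \<open>p = 0\<close>. The terms in \<open>p\<close> differ only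
  by a vector in the range of \<open>G\<close>, whatever \<open>Kd\<close> is.\<close>

definition matching :: "real^'n^'n \<Rightarrow> real^'n^'n \<Rightarrow> bool" where
  "matching Mh Sh \<longleftrightarrow> (\<forall>q. \<exists>w. Mh *v (matrix_inv M *v (Sh *v q)) = S *v q + G *v w)"

lemma M_T [simp]: "M *v T q = S *v q"
  by (simp add: T_def M)

lemma M_B [simp]: "M *v B w = G *v w"
  by (simp add: B_def M)

lemma linear_T: "linear T"
  unfolding T_def matrix_vector_mul_assoc by simp

lemma linear_B: "linear B"
  unfolding B_def matrix_vector_mul_assoc by simp

lemma T_selfadjoint: "inner (T x) (M *v y) = inner x (M *v T y)"
  by (simp add: pos_def_inner[OF M] symmetric_inner[OF S])

lemma subspace_W: "subspace W"
  by (simp only: W_def subspace_controllable_subspace)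

lemma subspace_Z: "subspace Z"
  by (simp only: Z_def subspace_weighted_complement)

lemma B_in_W: "B w \<in> W"
  by (simp only: W_def input_in_controllable_subspace)

lemma T_in_W: "x \<in> W \<Longrightarrow> T x \<in> W"
  unfolding W_def by (rule controllable_subspace_invariant[OF linear_T])

lemma T_in_Z: "z \<in> Z \<Longrightarrow> T z \<in> Z"
  using T_in_W by (simp add: Z_def weighted_complement_def T_selfadjoint[symmetric] del: M_T)

lemma W_Z_disjoint: "x \<in> W \<Longrightarrow> x \<in> Z \<Longrightarrow> x = 0"
  unfolding Z_def by (rule weighted_complement_disjoint[OF M])

lemma W_Z_decomposition:
  obtains w z where "w \<in> W" "z \<in> Z" "x = w + z"
  unfolding Z_def using weighted_decomposition[OF M subspace_W] by metis

lemma Z_orthogonal_G: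
  assumes "z \<in> Z"
  shows "inner z (G *v w) = 0"
proof -
  have "inner (B w) (M *v z) = 0"
    using assms B_in_W by (simp add: Z_def weighted_complement_def)
  then have "inner (G *v w) z = 0" by (simp add: pos_def_inner[OF M])
  then show ?thesis by (simp add: inner_commute)
qed

text \<open>\<open>T\<close> can be moved across the inner product of \<open>M\<close>, so the \<open>M\<close>-orthogonal complement of
  \<open>U\<close> is \<open>T\<close>-invariant. It contains the range of \<open>B\<close>, hence \<open>W\<close>. This is the dual,
  Kalman-like way to recognize elements of \<open>Z\<close>.\<close>

lemma orthogonal_imp_in_Z:
  assumes U: "\<And>r. r \<in> U \<Longrightarrow> T r \<in> U" "\<And>r w. r \<in> U \<Longrightarrow> inner r (G *v w) = 0" and z: "z \<in> U"
  shows "z \<in> Z"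
proof -
  have "W \<subseteq> {x. \<forall>r\<in>U. inner r (M *v x) = 0}"
    unfolding W_def
  proof (rule controllable_subspace_least)
    show "subspace {x. \<forall>r\<in>U. inner r (M *v x) = 0}"
      by (auto simp: subspace_def matrix_vector_right_distrib inner_add_right
          matrix_vector_mult_scaleR)
    show "B w \<in> {x. \<forall>r\<in>U. inner r (M *v x) = 0}" for w
      using U(2) by simp
    show "T x \<in> {x. \<forall>r\<in>U. inner r (M *v x) = 0}"
      if "x \<in> {x. \<forall>r\<in>U. inner r (M *v x) = 0}" for x
      using U(1) that by (simp add: T_selfadjoint[symmetric] del: M_T)
  qed
  then have "inner z (M *v e) = 0" if "e \<in> W" for e using that z by blast
  then show ?thesis
    unfolding Z_def weighted_complement_def
    by (simp add: pos_def_inner[OF M, of _ z] inner_commute[of "M *v _"])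
qed

lemma nonpositive_mode:
  assumes "\<not> positive_modes"
  obtains z l where "z \<in> Z" "z \<noteq> 0" "T z = l *\<^sub>R z" "l \<le> 0"
proof -
  obtain x where x: "x \<in> Z" "x \<noteq> 0" "inner x (S *v x) \<le> 0"
    using assms by (auto simp: positive_modes_def not_less)
  obtain z l where z: "z \<in> Z" "z \<noteq> 0" "T z = l *\<^sub>R z"
    and least: "\<forall>y\<in>Z. l * inner y (M *v y) \<le> inner y (M *v T y)"
    by (rule selfadjoint_least_eigenvector[OF M linear_T T_selfadjoint subspace_Z T_in_Z x(1,2)])
  have "l * inner x (M *v x) \<le> 0" using least x(1,3) by fastforce
  then have "l \<le> 0" using pos_def_pos[OF M x(2)] by (simp add: mult_le_0_iff)
  with z that show ?thesis by blast
qed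

lemma mode_S:
  assumes "T z = l *\<^sub>R z"
  shows "S *v z = l *\<^sub>R (M *v z)"
  using arg_cong[OF assms, of "(*v) M"] by (simp add: matrix_vector_mult_scaleR)

text \<open>Let \<open>z\<close> in \<open>Z\<close> be an eigenvector of \<open>T\<close> with eigenvalue \<open>l\<close>. As \<open>z\<close> is orthogonal to the range of \<open>G\<close>,
  pairing the matching equation with \<open>z\<close> gives
  \<open>inner (Mh *v z) (matrix_inv M *v (Sh *v q)) = l * inner z (M *v q)\<close> for every \<open>q\<close>. The choice
  \<open>M *v q = Mh *v z\<close> turns this into \<open>inner q (Sh *v q) = l * inner z (Mh *v z)\<close>, whence
  \<open>l > 0\<close>.\<close>

lemma matching_imp_positive_modes:
  assumes Mh: "pos_def Mh" and Sh: "pos_def Sh" and match: "matching Mh Sh"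
  shows "positive_modes"
proof (rule ccontr)
  assume "\<not> positive_modes"
  then obtain z l where z: "z \<in> Z" "z \<noteq> 0" "T z = l *\<^sub>R z" "l \<le> 0"
    by (rule nonpositive_mode)
  define q where "q = matrix_inv M *v (Mh *v z)"
  obtain w where w: "Mh *v (matrix_inv M *v (Sh *v q)) = S *v q + G *v w"
    using match unfolding matching_def by blast
  have Mhz: "Mh *v z = M *v q" by (simp add: q_def M)
  have "Mh *v z \<noteq> 0"
    using z(2) pos_def_pos[OF Mh z(2)] by auto
  then have "q \<noteq> 0" using Mhz by auto
  then have "0 < inner q (Sh *v q)" by (rule pos_def_pos[OF Sh])
  also have "inner q (Sh *v q) = inner (M *v q) (matrix_inv M *v (Sh *v q))"
    by (simp add: pos_def_inner[OF M, symmetric] M)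
  also have "\<dots> = inner z (S *v q + G *v w)"
    unfolding w[symmetric] Mhz[symmetric] by (simp only: pos_def_inner[OF Mh, symmetric])
  also have "\<dots> = inner (S *v z) q"
    by (simp add: inner_add_right Z_orthogonal_G[OF z(1)] symmetric_inner[OF S])
  also have "\<dots> = l * inner z (M *v q)"
    by (simp add: mode_S[OF z(3)] pos_def_inner[OF M])
  also have "\<dots> = l * inner z (Mh *v z)" by (simp only: Mhz)
  also have "\<dots> \<le> 0" using z(4) pos_def_nonneg[OF Mh] by (simp add: mult_le_0_iff)
  finally show False by simp
qed

text \<open>Call \<open>v\<close> admissible if \<open>T v + B w = s v\<close> for some \<open>w\<close> and some \<open>s > 0\<close>. Admissible vectors
  span \<open>W\<close> by the resolvent lemma, and they span \<open>Z\<close> because the eigenvectors of \<open>T\<close> in \<open>Z\<close>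
  have positive eigenvalues and are admissible with \<open>w = 0\<close>. On a basis \<open>V\<close> of admissible vectors put
  \<open>F v = w\<close>; then \<open>N = T + B F\<close> has \<open>V\<close> as a basis of eigenvectors with eigenvalues
  \<open>s v > 0\<close>. With the Gram maps \<open>P\<close> and \<open>R\<close> of \<open>V\<close> for the weights \<open>1\<close> and \<open>s\<close> this says
  \<open>N P = R\<close>, so \<open>N\<close> is the product of the two positive definite maps \<open>R\<close> and the inverse of \<open>P\<close>,
  and \<open>Mh = M R M\<close> and \<open>Sh\<close>, the inverse of \<open>P\<close>, solve the matching equation.\<close>

lemma positive_modes_imp_matching:
  assumes pos: "positive_modes"
  obtains Mh Sh where "pos_def Mh" "pos_def Sh" "matching Mh Sh"
proof -
  define E where "E = {v. \<exists>s>0. \<exists>w. T v + B w = s *\<^sub>R v}"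
  have "W \<subseteq> span E"
  proof -
    have "{v. \<exists>s>0. \<exists>w. T v - s *\<^sub>R v = B w} \<subseteq> E"
    proof clarify
      fix v s w assume h: "(s::real) > 0" "T v - s *\<^sub>R v = B w"
      have "T v + B (- w) = s *\<^sub>R v"
        using h(2) by (simp add: linear_neg[OF linear_B] flip: h(2))
      then show "v \<in> E" using h(1) by (auto simp: E_def)
    qed
    then show ?thesis
      using controllable_subspace_resolvent[OF linear_T, of B] span_mono
      unfolding W_def by blast
  qed
  moreover have "Z \<subseteq> span E"
  proof -
    have "{z \<in> Z. \<exists>l. T z = l *\<^sub>R z} \<subseteq> span E"
    proof clarify
      fix z l assume z: "z \<in> Z" "T z = l *\<^sub>R z"
      show "z \<in> span E"
      proof (cases "z = 0")
        case False
        have "0 < inner z (S *v z)" using pos z(1) False by (simp add: positive_modes_def)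
        also have "\<dots> = l * inner z (M *v z)" by (simp add: mode_S[OF z(2)])
        finally have "l > 0" using pos_def_pos[OF M False] by (simp add: zero_less_mult_iff)
        moreover have "T z + B 0 = l *\<^sub>R z" using z(2) by (simp add: linear_0[OF linear_B])
        ultimately have "z \<in> E" unfolding E_def by blast
        then show ?thesis by (rule span_base)
      qed (simp add: span_zero)
    qed
    then have "span {z \<in> Z. \<exists>l. T z = l *\<^sub>R z} \<subseteq> span E"
      by (intro span_minimal) auto
    then show ?thesis
      using selfadjoint_eigenvectors_span[OF M linear_T T_selfadjoint subspace_Z T_in_Z] by blast
  qed
  ultimately have "x \<in> span E" for x
    using W_Z_decomposition[of x] by (metis span_add subsetD)
  then have E: "span E = UNIV" by blast
  obtain V where V: "V \<subseteq> E" "independent V" "E \<subseteq> span V"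
    using maximal_independent_subset[of E] by blast
  have finV: "finite V" using V(2) by (rule independent_imp_finite)
  have "span E \<subseteq> span V" using V(3) by (intro span_minimal) simp_all
  then have spV: "span V = UNIV" using E by blast
  have "\<forall>v\<in>V. \<exists>s w. 0 < s \<and> T v + B w = s *\<^sub>R v" using V(1) unfolding E_def by blast
  then obtain s w where sw: "\<And>v. v \<in> V \<Longrightarrow> 0 < s v" "\<And>v. v \<in> V \<Longrightarrow> T v + B (w v) = s v *\<^sub>R v"
    unfolding bchoice_iff by blast
  obtain F where F: "linear F" "\<And>v. v \<in> V \<Longrightarrow> F v = w v"
    using linear_independent_extend[OF V(2), of w] by blast
  define P where "P y = (\<Sum>v\<in>V. (1 * inner v y) *\<^sub>R v)" for y
  define R where "R y = (\<Sum>v\<in>V. (s v * inner v y) *\<^sub>R v)" for y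
  have P: "linear P" "pos_def (matrix P)"
    using weighted_gram(1)[OF finV spV, of "\<lambda>_. 1"]
      weighted_gram_pos_def[OF finV spV, of "\<lambda>_. 1"] unfolding P_def[abs_def] by simp_all
  have R: "linear R" "pos_def (matrix R)"
    using weighted_gram(1)[OF finV spV, of s] weighted_gram_pos_def[OF finV spV, of s] sw(1)
    unfolding R_def[abs_def] by simp_all
  have mP: "matrix P *v y = P y" and mR: "matrix R *v y = R y" for y
    by (rule matrix_works; simp add: linear_matrix_vector_mul_eq P R)+
  have TP: "T (P y) + B (F (P y)) = R y" for y
  proof -
    have "linear (\<lambda>x. T x + B (F x))"
      using linear_compose_add[OF linear_T linear_compose[OF F(1) linear_B]]
      by (simp add: o_def)
    from linear_sum[OF this, of "\<lambda>v. inner v y *\<^sub>R v" V] linear_scale[OF this]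
    have "T (P y) + B (F (P y)) = (\<Sum>v\<in>V. inner v y *\<^sub>R (T v + B (F v)))"
      by (simp add: P_def)
    also have "\<dots> = R y" unfolding R_def
      by (intro sum.cong) (simp_all add: F sw(2) mult.commute)
    finally show ?thesis .
  qed
  define Mh where "Mh = matrix (\<lambda>x. M *v (R (M *v x)))"
  have linMh: "linear (\<lambda>x. M *v (R (M *v x)))"
    using linear_compose[OF linear_compose[OF matrix_vector_mul_linear R(1)]
        matrix_vector_mul_linear, of M M] by (simp add: o_def)
  have mMh: "Mh *v x = M *v (R (M *v x))" for x
    unfolding Mh_def by (rule matrix_works) (simp add: linear_matrix_vector_mul_eq linMh)
  show ?thesis
  proof
    show "pos_def Mh"
      unfolding Mh_def
    proof (rule pos_def_matrix[OF linMh])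
      show "inner x (M *v R (M *v y)) = inner (M *v R (M *v x)) y" for x y
        using pos_def_inner[OF R(2), of "M *v x" "M *v y"]
        by (simp add: mR pos_def_inner[OF M, of x] pos_def_inner[OF M, of _ y, symmetric])
      show "0 < inner x (M *v R (M *v x))" if "x \<noteq> 0" for x
      proof -
        have "M *v x \<noteq> 0" using pos_def_pos[OF M that] by auto
        from pos_def_pos[OF R(2) this] show ?thesis
          by (simp add: mR pos_def_inner[OF M, of x])
      qed
    qed
    show "pos_def (matrix_inv (matrix P))" by (rule pos_def_matrix_inv[OF P(2)])
    show "matching Mh (matrix_inv (matrix P))"
      unfolding matching_def
    proof
      fix q
      define y where "y = matrix_inv (matrix P) *v q"
      have "P y = q" using pos_def_inv_cancel(1)[OF P(2), of q] by (simp add: y_def mP)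
      then have "Mh *v (matrix_inv M *v y) = S *v q + G *v F q"
        using TP[of y] by (simp add: mMh M matrix_vector_right_distrib flip: TP)
      then show "\<exists>w. Mh *v (matrix_inv M *v (matrix_inv (matrix P) *v q)) = S *v q + G *v w"
        unfolding y_def by blast
    qed
  qed
qed

lemma feedback_imp_matching:
  assumes "feedback_transforms M S G u (target_field M G Mh Sh Kd)"
  shows "matching Mh Sh"
  unfolding matching_def
proof
  fix q
  have "- (S *v q) + G *v u (q, 0) = - ((Mh ** matrix_inv M ** Sh) *v q)"
    using assms[unfolded feedback_transforms_def, rule_format, of "(q, 0)"]
    by (simp add: drift_def input_map_def target_field_def)
  then have "S *v q - G *v u (q, 0) = Mh *v (matrix_inv M *v (Sh *v q))"
    by (simp add: matrix_vector_mul_assoc[symmetric] algebra_simps)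
  then show "\<exists>w. Mh *v (matrix_inv M *v (Sh *v q)) = S *v q + G *v w"
    by (intro exI[of _ "- u (q, 0)"]) (simp add: linear_neg[OF matrix_vector_mul_linear])
qed

lemma matching_imp_feedback:
  assumes "matching Mh Sh"
  obtains u where "feedback_transforms M S G u (target_field M G Mh Sh Kd)"
proof -
  obtain w where w: "\<And>q. Mh *v (matrix_inv M *v (Sh *v q)) = S *v q + G *v w q"
    using choice[OF assms[unfolded matching_def]] by blast
  define u where "u = (\<lambda>(q, p). - w q - Kd *v (transpose G *v (matrix_inv Mh *v p)))"
  have "feedback_transforms M S G u (target_field M G Mh Sh Kd)"
    by (auto simp: feedback_transforms_def drift_def input_map_def target_field_def u_def w
        matrix_vector_mul_assoc[symmetric] linear_neg[OF matrix_vector_mul_linear]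
        linear_diff[OF matrix_vector_mul_linear])
  then show ?thesis by (rule that)
qed

end

section \<open>The uncontrollable part\<close>

text \<open>Square block matrices with diagonal blocks multiply like \<open>2 \<times> 2\<close> matrices over functions of
  the index. The uncontrollable part and its diagonalization are of this form.\<close>

lemma mat_diag_block_mult:
  fixes a b c e a' b' c' e' :: "nat \<Rightarrow> 'a::comm_ring_1"
  shows "four_block_mat (mat_diag d a) (mat_diag d b) (mat_diag d c) (mat_diag d e)
       * four_block_mat (mat_diag d a') (mat_diag d b') (mat_diag d c') (mat_diag d e')
     = four_block_mat
         (mat_diag d (\<lambda>i. a i * a' i + b i * c' i)) (mat_diag d (\<lambda>i. a i * b' i + b i * e' i))
         (mat_diag d (\<lambda>i. c i * a' i + e i * c' i)) (mat_diag d (\<lambda>i. c i * b' i + e i * e' i))"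
proof -
  have add: "mat_diag d f + mat_diag d g = mat_diag d (\<lambda>i. f i + g i)" for f g :: "nat \<Rightarrow> 'a"
    by (rule eq_matI) (auto simp: mat_diag_def)
  show ?thesis
    by (subst mult_four_block_mat[where ?nr1.0 = d and ?n1.0 = d and ?n2.0 = d and ?nr2.0 = d
          and ?nc1.0 = d and ?nc2.0 = d]) (simp_all add: add)
qed

text \<open>Up to a permutation of the basis, the matrix is a direct sum of the blocks with rows
  \<open>(0, \<omega> i)\<close> and \<open>(- \<omega> i, 0)\<close>, whose eigenvectors \<open>(1, \<i>)\<close> and \<open>(1, - \<i>)\<close> belong to
  the eigenvalues \<open>\<i> * \<omega> i\<close> and \<open>- \<i> * \<omega> i\<close>.\<close>

lemma oscillatory_rotation_blocks:
  fixes \<omega> :: "nat \<Rightarrow> real"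
  assumes \<omega>: "\<And>i. i < d \<Longrightarrow> \<omega> i \<noteq> 0"
  shows "oscillatory (four_block_mat (mat_diag d (\<lambda>_. 0)) (mat_diag d \<omega>)
    (mat_diag d (\<lambda>i. - \<omega> i)) (mat_diag d (\<lambda>_. 0)))"
    (is "oscillatory ?C")
proof -
  let ?D = "four_block_mat (mat_diag d (\<lambda>i. \<i> * \<omega> i)) (mat_diag d (\<lambda>_. 0))
    (mat_diag d (\<lambda>_. 0)) (mat_diag d (\<lambda>i. - \<i> * \<omega> i))"
  let ?P = "four_block_mat (mat_diag d (\<lambda>_. 1)) (mat_diag d (\<lambda>_. 1))
    (mat_diag d (\<lambda>_. \<i>)) (mat_diag d (\<lambda>_. - \<i>))"
  let ?Q = "four_block_mat (mat_diag d (\<lambda>_. 1 / 2)) (mat_diag d (\<lambda>_. - \<i> / 2))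
    (mat_diag d (\<lambda>_. 1 / 2)) (mat_diag d (\<lambda>_. \<i> / 2))"
  let ?X = "map_mat complex_of_real ?C"
  have X: "?X = four_block_mat (mat_diag d (\<lambda>_. 0)) (mat_diag d (\<lambda>i. complex_of_real (\<omega> i)))
    (mat_diag d (\<lambda>i. - complex_of_real (\<omega> i))) (mat_diag d (\<lambda>_. 0))"
    by (rule eq_matI) (auto simp: mat_diag_def)
  have one: "1\<^sub>m (d + d) = four_block_mat (mat_diag d (\<lambda>_. 1)) (mat_diag d (\<lambda>_. 0))
    (mat_diag d (\<lambda>_. 0)) (mat_diag d (\<lambda>_. 1 :: complex))"
    by (rule eq_matI) (auto simp: mat_diag_def)
  have carrier: "{?X, ?D, ?P, ?Q} \<subseteq> carrier_mat (d + d) (d + d)"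
    by (auto simp: mat_diag_def)
  have sim: "similar_mat ?X ?D"
  proof (rule similar_matI[OF carrier])
    show "?P * ?Q = 1\<^sub>m (d + d)" "?Q * ?P = 1\<^sub>m (d + d)"
      unfolding one mat_diag_block_mult by simp_all
    show "?X = ?P * ?D * ?Q"
      unfolding X mat_diag_block_mult by (simp add: algebra_simps)
  qed
  have diag: "diagonal_mat ?D"
    by (auto simp: diagonal_mat_def mat_diag_def)
  have "diagonalizable ?X"
    unfolding diagonalizable_def using sim diag by blast
  moreover have "z \<noteq> 0 \<and> Re z = 0" if "eigenvalue ?X z" for z
  proof -
    have "poly (char_poly ?X) z = 0"
      using that carrier eigenvalue_root_char_poly[of ?X "d + d"] by auto
    moreover have "char_poly ?X = (\<Prod>a\<leftarrow>diag_mat ?D. [:- a, 1:])"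
      unfolding char_poly_similar[OF sim]
    proof (rule char_poly_upper_triangular)
      show "?D \<in> carrier_mat (d + d) (d + d)" using carrier by blast
      show "upper_triangular ?D" by (auto simp: upper_triangular_def mat_diag_def)
    qed
    ultimately have "z \<in> set (diag_mat ?D)"
      by (auto simp: poly_prod_list)
    then show ?thesis
      using \<omega> by (auto simp: diag_mat_def mat_diag_def)
  qed
  ultimately show ?thesis by (simp add: oscillatory_def)
qed

lemma indexed_basis_within:
  fixes E :: "'a::euclidean_space set"
  obtains d :: nat and z where "\<forall>i<d. z i \<in> E"
    and "\<forall>c. (\<Sum>i<d. c i *\<^sub>R z i) = 0 \<longrightarrow> (\<forall>i<d. c i = 0)"
    and "\<forall>x\<in>span E. \<exists>c. x = (\<Sum>i<d. c i *\<^sub>R z i)"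
proof -
  obtain V where V: "V \<subseteq> E" "independent V" "E \<subseteq> span V"
    using maximal_independent_subset[of E] by blast
  have fin: "finite V" using V(2) by (rule independent_imp_finite)
  define d where "d = card V"
  obtain z where z: "bij_betw z {..<d} V"
    using ex_bij_betw_nat_finite[OF fin] unfolding d_def atLeast0LessThan by blast
  have re: "(\<Sum>v\<in>V. u v *\<^sub>R v) = (\<Sum>i<d. u (z i) *\<^sub>R z i)" for u
    by (rule sum.reindex_bij_betw[OF z, symmetric])
  have inv: "the_inv_into {..<d} z (z i) = i" if "i < d" for i
    using that z by (intro the_inv_into_f_f) (auto simp: bij_betw_def)
  show ?thesis
  proof (rule that)
    show "\<forall>i<d. z i \<in> E" using z V(1) by (auto simp: bij_betw_def)
    show "\<forall>c. (\<Sum>i<d. c i *\<^sub>R z i) = 0 \<longrightarrow> (\<forall>i<d. c i = 0)"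
    proof (intro allI impI)
      fix c i assume 0: "(\<Sum>i<d. c i *\<^sub>R z i) = 0" and i: "i < d"
      let ?u = "\<lambda>v. c (the_inv_into {..<d} z v)"
      have "(\<Sum>v\<in>V. ?u v *\<^sub>R v) = (\<Sum>i<d. c i *\<^sub>R z i)"
        unfolding re by (rule sum.cong) (simp_all add: inv)
      then have "\<forall>v\<in>V. ?u v = 0"
        using 0 V(2) dependent_finite[OF fin] by auto
      moreover have "z i \<in> V" using z i by (auto simp: bij_betw_def)
      ultimately have "c (the_inv_into {..<d} z (z i)) = 0" by blast
      then show "c i = 0" using inv[OF i] by simp
    qed
    show "\<forall>x\<in>span E. \<exists>c. x = (\<Sum>i<d. c i *\<^sub>R z i)"
    proof
      fix x assume "x \<in> span E"
      moreover have "span E \<subseteq> span V" using V(3) by (intro span_minimal) simp_all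
      ultimately have "x \<in> span V" by blast
      then obtain u where "x = (\<Sum>v\<in>V. u v *\<^sub>R v)" unfolding span_finite[OF fin] by blast
      then show "\<exists>c. x = (\<Sum>i<d. c i *\<^sub>R z i)" unfolding re by (intro exI[of _ "\<lambda>i. u (z i)"])
    qed
  qed
qed

context hamiltonian_system
begin

abbreviation "K \<equiv> controllable_subspace (drift M S) (input_map G)"

lemma linear_drift: "linear (drift M S)"
proof (rule linearI)
  show "drift M S (x + y) = drift M S x + drift M S y" for x y
    by (cases x; cases y) (simp add: drift_def matrix_vector_right_distrib)
  show "drift M S (c *\<^sub>R x) = c *\<^sub>R drift M S x" for c x
    by (cases x) (simp add: drift_def matrix_vector_mult_scaleR)
qed

text \<open>The second-order structure: the drift maps \<open>(x, 0)\<close> to \<open>(0, - M *v T x)\<close> and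
  \<open>(0, M *v x)\<close> to \<open>(x, 0)\<close>, so the controllable subspace of the state space is \<open>W\<close> in the positions
  and \<open>M W\<close> in the momenta.\<close>

lemma K_iff: "(q, p) \<in> K \<longleftrightarrow> q \<in> W \<and> matrix_inv M *v p \<in> W"
proof
  have "K \<subseteq> {(q, p). q \<in> W \<and> matrix_inv M *v p \<in> W}"
  proof (rule controllable_subspace_least)
    show "subspace {(q, p). q \<in> W \<and> matrix_inv M *v p \<in> W}"
      using subspace_W by (auto simp: subspace_def zero_prod_def matrix_vector_right_distrib
          matrix_vector_mult_scaleR)
    show "input_map G w \<in> {(q, p). q \<in> W \<and> matrix_inv M *v p \<in> W}" for w
      using B_in_W[of w] subspace_0[OF subspace_W] by (simp add: input_map_def B_def)
    show "drift M S x \<in> {(q, p). q \<in> W \<and> matrix_inv M *v p \<in> W}"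
      if "x \<in> {(q, p). q \<in> W \<and> matrix_inv M *v p \<in> W}" for x
      using that subspace_neg[OF subspace_W T_in_W[of "fst x"]]
      by (auto simp: drift_def T_def linear_neg[OF matrix_vector_mul_linear])
  qed
  then show "(q, p) \<in> K \<Longrightarrow> q \<in> W \<and> matrix_inv M *v p \<in> W" by blast
next
  have inv: "drift M S x \<in> K" if "x \<in> K" for x
    by (rule controllable_subspace_invariant[OF linear_drift that])
  have "W \<subseteq> {x. (x, 0) \<in> K \<and> (0, M *v x) \<in> K}"
    unfolding W_def
  proof (rule controllable_subspace_least)
    have *: "subspace K" by (rule subspace_controllable_subspace)
    show "subspace {x. (x, 0) \<in> K \<and> (0, M *v x) \<in> K}"
      using subspace_0[OF *] subspace_add[OF *, of "(_, 0)" "(_, 0)"]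
        subspace_add[OF *, of "(0, _)" "(0, _)"] subspace_scale[OF *, of "(_, 0)"]
        subspace_scale[OF *, of "(0, _)"]
      by (auto simp: subspace_def zero_prod_def matrix_vector_right_distrib
          matrix_vector_mult_scaleR)
    show "B w \<in> {x. (x, 0) \<in> K \<and> (0, M *v x) \<in> K}" for w
    proof -
      have "(0, G *v w) \<in> K"
        using input_in_controllable_subspace[of "input_map G" w] by (simp add: input_map_def)
      with inv[OF this] show ?thesis by (simp add: drift_def B_def M)
    qed
    show "T x \<in> {x. (x, 0) \<in> K \<and> (0, M *v x) \<in> K}"
      if "x \<in> {x. (x, 0) \<in> K \<and> (0, M *v x) \<in> K}" for x
    proof -
      have "(0, - (S *v x)) \<in> K" using inv[of "(x, 0)"] that by (simp add: drift_def)
      from subspace_neg[OF * this] have "(0, S *v x) \<in> K" by simp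
      with inv[OF this] show ?thesis by (simp add: drift_def T_def M)
    qed
  qed
  then show "(q, p) \<in> K" if "q \<in> W \<and> matrix_inv M *v p \<in> W"
  proof -
    have "(q, 0) \<in> K" "(0, M *v (matrix_inv M *v p)) \<in> K"
      using that \<open>W \<subseteq> _\<close> by blast+
    then have "(q, 0) + (0, p) \<in> K"
      by (intro subspace_add[OF subspace_controllable_subspace]) (simp_all add: M)
    then show ?thesis by simp
  qed
qed

lemma controllable_iff: "controllable (drift M S) (input_map G) \<longleftrightarrow> Z \<subseteq> {0}"
proof -
  have "K = UNIV \<longleftrightarrow> W = UNIV"
  proof
    assume "K = UNIV"
    then show "W = UNIV" using K_iff by blast
  next
    assume "W = UNIV"
    then show "K = UNIV" using K_iff by auto
  qed
  also have "\<dots> \<longleftrightarrow> Z \<subseteq> {0}"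
  proof
    assume "W = UNIV"
    then show "Z \<subseteq> {0}" using W_Z_disjoint by blast
  next
    assume Z: "Z \<subseteq> {0}"
    have "x \<in> W" for x
    proof -
      obtain w z where wz: "w \<in> W" "z \<in> Z" "x = w + z" by (rule W_Z_decomposition)
      then have "z = 0" using Z by blast
      then show ?thesis using wz by simp
    qed
    then show "W = UNIV" by blast
  qed
  finally show ?thesis by (simp only: controllable_iff_UNIV)
qed

lemma controllable_imp_positive_modes:
  "controllable (drift M S) (input_map G) \<Longrightarrow> positive_modes"
  unfolding controllable_iff positive_modes_def by blast

text \<open>If the condition fails, some mode \<open>z\<close> has eigenvalue \<open>l = - \<mu>\<^sup>2 \<le> 0\<close>, and
  \<open>(z, \<mu> *\<^sub>R (M *v z))\<close> is an eigenvector of the drift for the real number \<open>\<mu>\<close>. It is nonzero modulo the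
  controllable subspace, so \<open>\<mu>\<close> is an eigenvalue of the uncontrollable part, in whatever
  basis. An oscillatory matrix has no real eigenvalue.\<close>

lemma oscillatory_imp_positive_modes:
  assumes C: "uncontrollable_part (drift M S) (input_map G) C" and osc: "oscillatory C"
  shows "positive_modes"
proof (rule ccontr)
  assume "\<not> positive_modes"
  then obtain z l where z: "z \<in> Z" "z \<noteq> 0" "T z = l *\<^sub>R z" "l \<le> 0"
    by (rule nonpositive_mode)
  define \<mu> where "\<mu> = sqrt (- l)"
  have \<mu>2: "\<mu> * \<mu> = - l" using z(4) by (simp add: \<mu>_def)
  define y where "y = (z, \<mu> *\<^sub>R (M *v z))"
  have Ay: "drift M S y = \<mu> *\<^sub>R y"
    using \<mu>2 by (simp add: y_def drift_def matrix_vector_mult_scaleR M mode_S[OF z(3)])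
  have yK: "y \<notin> K" using W_Z_disjoint z(1,2) by (auto simp: y_def K_iff)
  obtain r b where Cr: "C \<in> carrier_mat r r" and b: "quotient_basis K r b"
    and Ab: "\<And>j. j < r \<Longrightarrow> drift M S (b j) - (\<Sum>i<r. (C $$ (i, j)) *\<^sub>R b i) \<in> K"
    using C unfolding uncontrollable_part_def quotient_map_matrix_def by blast
  have *: "subspace K" by (rule subspace_controllable_subspace)
  obtain c where c: "y - (\<Sum>i<r. c i *\<^sub>R b i) \<in> K"
    using b unfolding quotient_basis_def by blast
  \<comment> \<open>\<open>?e\<close> is the coordinate vector of \<open>C c - \<mu> c\<close>; it vanishes because it represents \<open>0\<close> in the quotient.\<close>
  let ?e = "\<lambda>i. (\<Sum>j<r. C $$ (i, j) * c j) - \<mu> * c i"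
  have "(\<Sum>i<r. ?e i *\<^sub>R b i) \<in> K"
  proof -
    have 1: "\<mu> *\<^sub>R y - (\<Sum>j<r. c j *\<^sub>R drift M S (b j)) \<in> K"
      using controllable_subspace_invariant[OF linear_drift c]
      by (simp add: linear_diff[OF linear_drift] linear_sum[OF linear_drift]
          linear_scale[OF linear_drift] Ay)
    have 2: "(\<Sum>j<r. c j *\<^sub>R (drift M S (b j) - (\<Sum>i<r. (C $$ (i, j)) *\<^sub>R b i))) \<in> K"
      using Ab by (intro subspace_sum[OF *] subspace_scale[OF *]) auto
    have 3: "\<mu> *\<^sub>R (y - (\<Sum>i<r. c i *\<^sub>R b i)) \<in> K"
      by (rule subspace_scale[OF * c])
    have swap: "(\<Sum>j<r. c j *\<^sub>R (\<Sum>i<r. (C $$ (i, j)) *\<^sub>R b i))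
        = (\<Sum>i<r. (\<Sum>j<r. C $$ (i, j) * c j) *\<^sub>R b i)"
    proof -
      have "(\<Sum>j<r. c j *\<^sub>R (\<Sum>i<r. (C $$ (i, j)) *\<^sub>R b i))
        = (\<Sum>j<r. \<Sum>i<r. (C $$ (i, j) * c j) *\<^sub>R b i)"
        by (simp add: scaleR_sum_right mult.commute)
      also have "\<dots> = (\<Sum>i<r. \<Sum>j<r. (C $$ (i, j) * c j) *\<^sub>R b i)"
        by (rule sum.swap)
      finally show ?thesis by (simp only: scaleR_sum_left)
    qed
    have "(\<Sum>i<r. ?e i *\<^sub>R b i)
      = \<mu> *\<^sub>R (y - (\<Sum>i<r. c i *\<^sub>R b i))
        - ((\<mu> *\<^sub>R y - (\<Sum>j<r. c j *\<^sub>R drift M S (b j)))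
          + (\<Sum>j<r. c j *\<^sub>R (drift M S (b j) - (\<Sum>i<r. (C $$ (i, j)) *\<^sub>R b i))))"
    proof -
      have "\<mu> *\<^sub>R (\<Sum>i<r. c i *\<^sub>R b i) = (\<Sum>i<r. (\<mu> * c i) *\<^sub>R b i)"
        by (simp add: scaleR_sum_right)
      then show ?thesis
        by (simp add: scaleR_left_diff_distrib scaleR_right_diff_distrib sum_subtractf swap)
    qed
    also have "\<dots> \<in> K" by (intro subspace_diff[OF *] subspace_add[OF *] 1 2 3)
    finally show ?thesis .
  qed
  then have e: "(\<Sum>j<r. C $$ (i, j) * c j) = \<mu> * c i" if "i < r" for i
    using b that unfolding quotient_basis_def by fastforce
  define v where "v = Matrix.vec r c"
  have "eigenvector C v \<mu>"
    unfolding eigenvector_def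
  proof (intro conjI)
    show "v \<in> carrier_vec (dim_row C)" using Cr by (simp add: v_def)
    show "v \<noteq> 0\<^sub>v (dim_row C)"
    proof
      assume v0: "v = 0\<^sub>v (dim_row C)"
      have "c i = 0" if "i < r" for i
        using arg_cong[OF v0, of "\<lambda>x. Matrix.vec_index x i"] that Cr by (simp add: v_def)
      then show False using c yK by simp
    qed
    show "C *\<^sub>v v = \<mu> \<cdot>\<^sub>v v"
    proof (rule eq_vecI)
      fix i assume "i < dim_vec (\<mu> \<cdot>\<^sub>v v)"
      then have i: "i < r" by (simp add: v_def)
      then show "Matrix.vec_index (C *\<^sub>v v) i = Matrix.vec_index (\<mu> \<cdot>\<^sub>v v) i"
        using Cr e[OF i] by (simp add: v_def scalar_prod_def atLeast0LessThan)
    qed (use Cr in \<open>simp add: v_def\<close>)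
  qed
  then have "eigenvalue C \<mu>" unfolding eigenvalue_def by blast
  then have "eigenvalue (map_mat complex_of_real C) (complex_of_real \<mu>)"
    by (rule of_real_hom.eigenvalue_hom[OF Cr])
  then show False using osc unfolding oscillatory_def by fastforce
qed

text \<open>For a basis of modes \<open>z i\<close> of \<open>Z\<close> with eigenvalues \<open>(\<omega> i)\<^sup>2\<close>, the vectors
  \<open>(z i, 0)\<close> and \<open>(0, \<omega> i *\<^sub>R (M *v z i))\<close> represent a basis of the quotient by the controllable
  subspace, and the drift rotates each such pair with angular velocity \<open>\<omega> i\<close>.
  If \<open>Z\<close> is trivial, the matrix has no rows.\<close>

lemma positive_modes_imp_oscillatory:
  assumes pos: "positive_modes"
  obtains C where "uncontrollable_part (drift M S) (input_map G) C" "oscillatory C"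
proof -
  obtain d :: nat and z where zE: "\<forall>i<d. z i \<in> {z \<in> Z. \<exists>l. T z = l *\<^sub>R z}"
    and indep: "\<forall>c. (\<Sum>i<d. c i *\<^sub>R z i) = 0 \<longrightarrow> (\<forall>i<d. c i = 0)"
    and gen: "\<forall>x\<in>span {z \<in> Z. \<exists>l. T z = l *\<^sub>R z}. \<exists>c. x = (\<Sum>i<d. c i *\<^sub>R z i)"
    by (rule indexed_basis_within[of "{z \<in> Z. \<exists>l. T z = l *\<^sub>R z}"])
  have zZ: "z i \<in> Z" if "i < d" for i using zE that by blast
  have z0: "z i \<noteq> 0" if "i < d" for i
  proof
    assume "z i = 0"
    then have "(\<Sum>j<d. (if j = i then 1 else 0) *\<^sub>R z j) = 0"
      by (intro sum.neutral) auto
    from indep[rule_format, OF this that] show False by simp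
  qed
  have "\<exists>w>0. T (z i) = (w * w) *\<^sub>R z i" if i: "i < d" for i
  proof -
    obtain l where l: "T (z i) = l *\<^sub>R z i" using zE i by blast
    have "0 < inner (z i) (S *v z i)" using pos zZ[OF i] z0[OF i] by (simp add: positive_modes_def)
    also have "\<dots> = l * inner (z i) (M *v z i)" by (simp add: mode_S[OF l])
    finally have "l > 0" using pos_def_pos[OF M z0[OF i]] by (simp add: zero_less_mult_iff)
    then show ?thesis using l by (intro exI[of _ "sqrt l"]) simp
  qed
  then have "\<forall>i\<in>{..<d}. \<exists>w. 0 < w \<and> T (z i) = (w * w) *\<^sub>R z i" by blast
  from bchoice[OF this] obtain \<omega> where
    \<omega>': "\<forall>i\<in>{..<d}. 0 < \<omega> i \<and> T (z i) = (\<omega> i * \<omega> i) *\<^sub>R z i" ..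
  have \<omega>: "0 < \<omega> i" "T (z i) = (\<omega> i * \<omega> i) *\<^sub>R z i" if "i < d" for i
    using \<omega>' that by simp_all
  have \<omega>0: "\<omega> i \<noteq> 0" if "i < d" for i using \<omega>(1)[OF that] by simp
  define b where "b i = (if i < d then (z i, 0) else (0, \<omega> (i - d) *\<^sub>R (M *v z (i - d))))" for i
  have sum_b: "(\<Sum>i<d + d. c i *\<^sub>R b i)
      = (\<Sum>i<d. c i *\<^sub>R z i, M *v (\<Sum>i<d. (c (d + i) * \<omega> i) *\<^sub>R z i))" for c
  proof -
    have "(\<Sum>i<d + d. c i *\<^sub>R b i) = (\<Sum>i<d. c i *\<^sub>R b i) + (\<Sum>i<d. c (d + i) *\<^sub>R b (d + i))"
    proof -
      have "(\<Sum>i<d + e. f i) = (\<Sum>i<d. f i) + (\<Sum>i<e. f (d + i))" for e and f :: "nat \<Rightarrow> 'v::real_vector"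
        by (induction e) (simp_all add: add.assoc)
      then show ?thesis .
    qed
    also have "(\<Sum>i<d. c i *\<^sub>R b i) = (\<Sum>i<d. c i *\<^sub>R z i, 0)"
      by (simp add: b_def prod_eq_iff fst_sum snd_sum)
    also have "(\<Sum>i<d. c (d + i) *\<^sub>R b (d + i)) = (0, M *v (\<Sum>i<d. (c (d + i) * \<omega> i) *\<^sub>R z i))"
      by (simp add: b_def prod_eq_iff fst_sum snd_sum linear_sum[OF matrix_vector_mul_linear]
          matrix_vector_mult_scaleR)
    finally show ?thesis by simp
  qed
  have sumZ: "(\<Sum>i<d. c i *\<^sub>R z i) \<in> Z" for c
    by (intro subspace_sum[OF subspace_Z] subspace_scale[OF subspace_Z]) (auto intro: zZ)
  let ?C = "four_block_mat (mat_diag d (\<lambda>_. 0)) (mat_diag d \<omega>)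
    (mat_diag d (\<lambda>i. - \<omega> i)) (mat_diag d (\<lambda>_. 0))"
  have "quotient_basis K (d + d) b"
    unfolding quotient_basis_def
  proof (intro conjI allI impI)
    fix c i assume inK: "(\<Sum>i<d + d. c i *\<^sub>R b i) \<in> K" and i: "i < d + d"
    have "(\<Sum>i<d. c i *\<^sub>R z i) = 0" "(\<Sum>i<d. (c (d + i) * \<omega> i) *\<^sub>R z i) = 0"
      using inK unfolding sum_b K_iff by (auto simp: M intro: W_Z_disjoint sumZ)
    from indep[rule_format, OF this(1)] indep[rule_format, OF this(2)]
    have c0: "c k = 0" "c (d + k) * \<omega> k = 0" if "k < d" for k using that by blast+
    show "c i = 0"
    proof (cases "i < d")
      case False
      then have "i - d < d" "d + (i - d) = i" using i by simp_all
      then show ?thesis using c0(2)[of "i - d"] \<omega>(1)[of "i - d"] by simp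
    qed (rule c0(1))
  next
    fix x :: "(real^'n) \<times> (real^'n)"
    obtain q p where x: "x = (q, p)" by (cases x)
    have mod_W: "\<exists>c. y - (\<Sum>i<d. c i *\<^sub>R z i) \<in> W" for y
    proof -
      obtain w s where ws: "w \<in> W" "s \<in> Z" "y = w + s" by (rule W_Z_decomposition)
      then obtain c where "s = (\<Sum>i<d. c i *\<^sub>R z i)"
        using gen[rule_format] selfadjoint_eigenvectors_span[OF M linear_T T_selfadjoint subspace_Z T_in_Z]
        by blast
      then show ?thesis using ws by (intro exI[of _ c]) simp
    qed
    obtain c1 where c1: "q - (\<Sum>i<d. c1 i *\<^sub>R z i) \<in> W" using mod_W by blast
    obtain c2 where c2: "matrix_inv M *v p - (\<Sum>i<d. c2 i *\<^sub>R z i) \<in> W" using mod_W by blast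
    define c where "c i = (if i < d then c1 i else c2 (i - d) / \<omega> (i - d))" for i
    have "(\<Sum>i<d. c i *\<^sub>R z i) = (\<Sum>i<d. c1 i *\<^sub>R z i)"
      by (simp add: c_def)
    moreover have "(\<Sum>i<d. (c (d + i) * \<omega> i) *\<^sub>R z i) = (\<Sum>i<d. c2 i *\<^sub>R z i)"
      by (intro sum.cong) (simp_all add: c_def \<omega>0)
    ultimately have "x - (\<Sum>i<d + d. c i *\<^sub>R b i) \<in> K"
      using c1 c2 unfolding sum_b x by (simp add: K_iff M matrix_vector_mult_diff_distrib)
    then show "\<exists>c. x - (\<Sum>i<d + d. c i *\<^sub>R b i) \<in> K" by blast
  qed
  moreover have "drift M S (b j) - (\<Sum>i<d + d. (?C $$ (i, j)) *\<^sub>R b i) \<in> K" if j: "j < d + d" for j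
  proof -
    have "drift M S (b j) = (\<Sum>i<d + d. (?C $$ (i, j)) *\<^sub>R b i)"
    proof (cases "j < d")
      case True
      have "(\<Sum>i<d + d. (?C $$ (i, j)) *\<^sub>R b i)
        = (\<Sum>i<d + d. if i = d + j then (- \<omega> j) *\<^sub>R b i else 0)"
        using True by (intro sum.cong) (auto simp: mat_diag_def)
      also have "\<dots> = (- \<omega> j) *\<^sub>R b (d + j)" using True by simp
      also have "\<dots> = drift M S (b j)"
        using True by (simp add: b_def drift_def mode_S[OF \<omega>(2)])
      finally show ?thesis by (rule sym)
    next
      case False
      have "(\<Sum>i<d + d. (?C $$ (i, j)) *\<^sub>R b i)
        = (\<Sum>i<d + d. if i = j - d then \<omega> i *\<^sub>R b i else 0)"
        using False j by (intro sum.cong) (auto simp: mat_diag_def)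
      also have "\<dots> = \<omega> (j - d) *\<^sub>R b (j - d)"
      proof -
        have "j - d < d + d" using j by simp
        then show ?thesis by simp
      qed
      also have "\<dots> = drift M S (b j)"
        using False j by (simp add: b_def drift_def M matrix_vector_mult_scaleR)
      finally show ?thesis by (rule sym)
    qed
    then show ?thesis using subspace_0[OF subspace_controllable_subspace] by simp
  qed
  moreover have "?C \<in> carrier_mat (d + d) (d + d)" by (auto simp: mat_diag_def)
  ultimately have "uncontrollable_part (drift M S) (input_map G) ?C"
    unfolding uncontrollable_part_def quotient_map_matrix_def
    by (intro exI[of _ "d + d"] exI[of _ b] conjI) simp_all
  moreover have "oscillatory ?C"
    by (rule oscillatory_rotation_blocks) (rule \<omega>0)
  ultimately show ?thesis by (rule that)
qed

end

section \<open>Exponential stability\<close>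

lemma positive_form_coercive:
  fixes P :: "'a::euclidean_space \<Rightarrow> 'a"
  assumes P: "linear P" and pos: "\<And>x. x \<noteq> 0 \<Longrightarrow> 0 < inner x (P x)"
  obtains \<alpha> where "0 < \<alpha>" "\<forall>x. \<alpha> * (norm x)\<^sup>2 \<le> inner x (P x)"
proof -
  have cont: "continuous_on (sphere 0 1) (\<lambda>x. inner x (P x))"
    using P by (intro continuous_intros linear_continuous_on) (simp add: linear_conv_bounded_linear)
  obtain b :: 'a where "b \<in> Basis" using nonempty_Basis by blast
  then have "b \<in> sphere 0 1" by simp
  then obtain z where z: "z \<in> sphere 0 1"
    and least: "\<And>x. x \<in> sphere 0 1 \<Longrightarrow> inner z (P z) \<le> inner x (P x)"
    using continuous_attains_inf[OF compact_sphere _ cont] by blast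
  have "inner z (P z) * (norm x)\<^sup>2 \<le> inner x (P x)" for x
  proof (cases "x = 0")
    case False
    then have "x /\<^sub>R norm x \<in> sphere 0 1" by simp
    from least[OF this] have "inner z (P z) \<le> inner x (P x) / (norm x)\<^sup>2"
      by (simp add: linear_scale[OF P] divide_inverse power2_eq_square mult_ac)
    then show ?thesis using False by (simp add: pos_le_divide_eq)
  qed (simp add: linear_0[OF P])
  then have "\<forall>x. inner z (P z) * (norm x)\<^sup>2 \<le> inner x (P x)" ..
  moreover have "0 < inner z (P z)" using z by (intro pos) auto
  ultimately show ?thesis by (intro that)
qed

lemma exponential_decay:
  fixes v v' :: "real \<Rightarrow> real"
  assumes v: "\<And>t. 0 \<le> t \<Longrightarrow> (v has_real_derivative v' t) (at t within {0..})"
    and le: "\<And>t. 0 \<le> t \<Longrightarrow> v' t \<le> - r * v t" and t: "0 \<le> t"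
  shows "v t \<le> exp (- r * t) * v 0"
proof -
  define g where "g s = exp (r * s) * v s" for s
  have g: "(g has_real_derivative exp (r * s) * (r * v s + v' s)) (at s within {0..t})"
    if "0 \<le> s" for s
  proof -
    have "(v has_real_derivative v' s) (at s within {0..t})"
      by (rule DERIV_subset[OF v[OF that]]) auto
    moreover have "((\<lambda>s. exp (r * s)) has_real_derivative exp (r * s) * r) (at s within {0..t})"
      by (auto intro!: derivative_eq_intros)
    ultimately have "((\<lambda>s. exp (r * s) * v s) has_real_derivative
        exp (r * s) * r * v s + v' s * exp (r * s)) (at s within {0..t})"
      by (rule DERIV_mult[rotated])
    moreover have "exp (r * s) * r * v s + v' s * exp (r * s) = exp (r * s) * (r * v s + v' s)"
      by (simp add: distrib_left)
    ultimately show ?thesis unfolding g_def[abs_def] by (simp only:)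
  qed
  have "g t \<le> g 0"
  proof (rule DERIV_nonpos_imp_decreasing_open[OF t])
    fix s assume s: "0 < s" "s < t"
    have "at s within {0..t} = at s" using s by (rule at_within_Icc_at)
    then have "(g has_real_derivative exp (r * s) * (r * v s + v' s)) (at s)"
      using g[of s] s by simp
    moreover have "exp (r * s) * (r * v s + v' s) \<le> 0"
      using le[of s] s by (intro mult_nonneg_nonpos) simp_all
    ultimately show "\<exists>y. (g has_real_derivative y) (at s) \<and> y \<le> 0" by blast
  next
    show "continuous_on {0..t} g"
      by (rule DERIV_continuous_on, rule g) simp
  qed
  then have "exp (r * t) * v t \<le> v 0" by (simp add: g_def)
  then have "exp (- r * t) * (exp (r * t) * v t) \<le> exp (- r * t) * v 0"
    by (intro mult_left_mono) simp_all
  moreover have "exp (- r * t) * (exp (r * t) * v t) = v t"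
    by (simp only: mult.assoc[symmetric] mult_exp_exp) simp
  ultimately show ?thesis by (simp only:)
qed

text \<open>The inequality for \<open>P\<close> gives \<open>v' \<le> - 2 a v\<close> for \<open>v t = inner (x t) (P (x t))\<close>, and \<open>v\<close> is
  equivalent to the squared norm.\<close>

lemma strict_Lyapunov_imp_exponentially_stable:
  fixes f P :: "'a::euclidean_space \<Rightarrow> 'a"
  assumes P: "linear P" and sym: "\<And>x y. inner x (P y) = inner (P x) y"
    and pos: "\<And>x. x \<noteq> 0 \<Longrightarrow> 0 < inner x (P x)"
    and \<beta>: "0 < \<beta>" and decr: "\<And>x. inner x (P (f x)) \<le> - \<beta> * (norm x)\<^sup>2"
  shows "exponentially_stable f"
proof -
  obtain \<alpha> where \<alpha>: "0 < \<alpha>" "\<forall>x. \<alpha> * (norm x)\<^sup>2 \<le> inner x (P x)"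
    by (rule positive_form_coercive[OF P pos])
  obtain C where C: "0 < C" "\<And>x. norm (P x) \<le> C * norm x"
    using linear_bounded_pos[OF P] by blast
  have upper: "inner x (P x) \<le> C * (norm x)\<^sup>2" for x
  proof -
    have "inner x (P x) \<le> norm x * norm (P x)" by (rule norm_cauchy_schwarz)
    also have "\<dots> \<le> norm x * (C * norm x)" by (intro mult_left_mono C) simp
    finally show ?thesis by (simp add: power2_eq_square mult_ac)
  qed
  define a where "a = \<beta> / C"
  have a: "0 < a" using \<beta> C by (simp add: a_def)
  have "norm (x t) \<le> sqrt (C / \<alpha>) * exp (- a * t) * norm (x 0)"
    if x: "solves_ode f x" and t: "0 \<le> t" for x t
  proof -
    define v where "v s = inner (x s) (P (x s))" for s
    have "v t \<le> exp (- (2 * a) * t) * v 0"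
    proof (rule exponential_decay[where v = v and r = "2 * a"
          and v' = "\<lambda>s. 2 * inner (x s) (P (f (x s)))", OF _ _ t])
      fix s :: real assume s: "0 \<le> s"
      have x': "(x has_vector_derivative f (x s)) (at s within {0..})"
        using x s by (simp add: solves_ode_def)
      have "((\<lambda>s. P (x s)) has_vector_derivative P (f (x s))) (at s within {0..})"
        by (rule bounded_linear.has_vector_derivative[OF _ x'])
          (use P in \<open>simp add: linear_conv_bounded_linear\<close>)
      from bounded_bilinear.has_vector_derivative[OF bounded_bilinear_inner x' this]
      show "(v has_real_derivative 2 * inner (x s) (P (f (x s)))) (at s within {0..})"
        unfolding v_def[abs_def] has_real_derivative_iff_has_vector_derivative
        using sym[of "x s" "f (x s)"] by (simp add: inner_commute)
      have "a * v s \<le> a * (C * (norm (x s))\<^sup>2)"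
        unfolding v_def using a by (intro mult_left_mono upper) simp
      also have "\<dots> = \<beta> * (norm (x s))\<^sup>2" using C by (simp add: a_def)
      finally show "2 * inner (x s) (P (f (x s))) \<le> - (2 * a) * v s"
        using decr[of "x s"] by simp
    qed
    also have "\<dots> \<le> exp (- (2 * a) * t) * (C * (norm (x 0))\<^sup>2)"
      unfolding v_def by (intro mult_left_mono upper) simp
    finally have "\<alpha> * (norm (x t))\<^sup>2 \<le> exp (- (2 * a) * t) * (C * (norm (x 0))\<^sup>2)"
      using \<alpha>(2)[rule_format, of "x t"] by (simp add: v_def)
    also have "exp (- (2 * a) * t) = (exp (- a * t))\<^sup>2"
      by (simp add: power2_eq_square mult_exp_exp)
    finally have "(norm (x t))\<^sup>2 \<le> (exp (- a * t))\<^sup>2 * (C * (norm (x 0))\<^sup>2) / \<alpha>"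
      by (simp only: pos_le_divide_eq[OF \<alpha>(1)] mult.commute[of "(norm (x t))\<^sup>2"])
    also have "\<dots> = (sqrt (C / \<alpha>) * exp (- a * t) * norm (x 0))\<^sup>2"
    proof -
      have "(sqrt (C / \<alpha>))\<^sup>2 = C / \<alpha>" using \<alpha>(1) C(1) by simp
      then show ?thesis by (simp only: power_mult_distrib) simp
    qed
    finally show ?thesis
      by (rule power2_le_imp_le) (intro mult_nonneg_nonneg real_sqrt_ge_zero divide_nonneg_pos
          \<alpha>(1) C(1)[THEN less_imp_le] exp_ge_zero norm_ge_zero)
  qed
  moreover have "0 < sqrt (C / \<alpha>)" using \<alpha>(1) C(1) by simp
  ultimately show ?thesis using a unfolding exponentially_stable_def by blast
qed

text \<open>A form of LaSalle's principle for linear fields: if the energy, half the form of \<open>P\<close>,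
  decreases at least at the rate
  \<open>\<kappa> (norm (C x))\<^sup>2\<close> and the output \<open>C\<close> is observable, then the field is exponentially stable.

  Here a strict Lyapunov function is constructed. By duality, observability makes the pair formed by
  \<open>- adjoint A\<close> and \<open>adjoint C\<close> controllable, so the resolvent lemma yields a basis \<open>V\<close> with
  \<open>- adjoint A v - s v = adjoint C w\<close> and \<open>s > 0\<close>. Along a trajectory each coordinate
  \<open>inner v x\<close> therefore satisfies \<open>y' = - s y - inner w (C x)\<close>: it decays up to an error controlled by the
  output. Hence \<open>R = \<Sum> (inner v x)\<^sup>2\<close> decreases up to a multiple of \<open>(norm (C x))\<^sup>2\<close>, which is
  absorbed by the dissipation of \<open>P\<close> in \<open>P + \<epsilon> R\<close> for small \<open>\<epsilon>\<close>.\<close>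

lemma observable_Lyapunov_imp_exponentially_stable:
  fixes A P :: "'a::euclidean_space \<Rightarrow> 'a" and C :: "'a \<Rightarrow> 'b::euclidean_space"
  assumes A: "linear A" and C: "linear C"
    and P: "linear P" and sym: "\<And>x y. inner x (P y) = inner (P x) y"
    and pos: "\<And>x. x \<noteq> 0 \<Longrightarrow> 0 < inner x (P x)"
    and \<kappa>: "0 < \<kappa>" and decr: "\<And>x. inner x (P (A x)) \<le> - \<kappa> * (norm (C x))\<^sup>2"
    and obs: "\<And>N x. subspace N \<Longrightarrow> (\<And>y. y \<in> N \<Longrightarrow> A y \<in> N) \<Longrightarrow> (\<And>y. y \<in> N \<Longrightarrow> C y = 0)
      \<Longrightarrow> x \<in> N \<Longrightarrow> x = 0"
  shows "exponentially_stable A"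
proof -
  let ?T = "\<lambda>x. - adjoint A x"
  let ?K = "controllable_subspace ?T (adjoint C)"
  let ?E = "{v. \<exists>s>0. \<exists>w. ?T v - s *\<^sub>R v = adjoint C w}"
  have T: "linear ?T" using adjoint_linear[OF A] by (rule linear_compose_neg)
  \<comment> \<open>The orthogonal complement of \<open>?K\<close> is \<open>A\<close>-invariant and contained in the kernel of \<open>C\<close>.\<close>
  have "?K = UNIV"
  proof (rule ccontr)
    assume K: "?K \<noteq> UNIV"
    have spK: "span ?K = ?K"
      by (rule span_eq_iff[THEN iffD2, OF subspace_controllable_subspace])
    obtain x where x: "x \<noteq> 0" "\<forall>y\<in>?K. inner x y = 0"
      using span_not_UNIV_orthogonal[of ?K, unfolded spK, OF K] by blast
    have "x = 0"
    proof (rule obs)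
      show "subspace {x. \<forall>y\<in>?K. inner x y = 0}"
        by (auto simp: subspace_def inner_add_left)
      show "A x \<in> {x. \<forall>y\<in>?K. inner x y = 0}" if "x \<in> {x. \<forall>y\<in>?K. inner x y = 0}" for x
      proof clarify
        fix y assume "y \<in> ?K"
        then have "inner x (?T y) = 0"
          using that controllable_subspace_invariant[OF T] by blast
        then show "inner (A x) y = 0" by (simp add: adjoint_works[OF A])
      qed
      show "C x = 0" if "x \<in> {x. \<forall>y\<in>?K. inner x y = 0}" for x
      proof -
        have "inner x (adjoint C (C x)) = 0"
          using that input_in_controllable_subspace[of "adjoint C" "C x" ?T] by blast
        then show ?thesis by (simp add: adjoint_works[OF C])
      qed
      show "x \<in> {x. \<forall>y\<in>?K. inner x y = 0}" using x(2) by blast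
    qed
    with x(1) show False ..
  qed
  then have E: "span ?E = UNIV" using controllable_subspace_resolvent[OF T, of "adjoint C"] by blast
  obtain V where V: "V \<subseteq> ?E" "independent V" "?E \<subseteq> span V"
    using maximal_independent_subset[of ?E] by blast
  have fin: "finite V" using V(2) by (rule independent_imp_finite)
  have "span ?E \<subseteq> span V" using V(3) by (intro span_minimal) simp_all
  then have spV: "span V = UNIV" using E by blast
  have "\<forall>v\<in>V. \<exists>s. 0 < s \<and> (\<exists>w. ?T v - s *\<^sub>R v = adjoint C w)" using V(1) by blast
  from bchoice[OF this] obtain s where s: "\<forall>v\<in>V. 0 < s v \<and> (\<exists>w. ?T v - s v *\<^sub>R v = adjoint C w)" ..
  then have "\<forall>v\<in>V. \<exists>w. ?T v - s v *\<^sub>R v = adjoint C w" by blast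
  from bchoice[OF this] obtain w where w: "\<forall>v\<in>V. ?T v - s v *\<^sub>R v = adjoint C (w v)" ..
  define R where "R x = (\<Sum>v\<in>V. (1 * inner v x) *\<^sub>R v)" for x
  have R: "linear R" "inner x (R y) = inner (R x) y" "x \<noteq> 0 \<Longrightarrow> 0 < inner x (R x)" for x y
    unfolding R_def[abs_def] by (rule weighted_gram[OF fin spV]; simp)+
  obtain \<gamma> where \<gamma>: "0 < \<gamma>"
    "\<forall>x. \<gamma> * (norm x)\<^sup>2 \<le> inner x (\<Sum>v\<in>V. (s v / 2 * inner v x) *\<^sub>R v)"
    by (rule positive_form_coercive[OF weighted_gram(1,3)[OF fin spV, of "\<lambda>v. s v / 2"]])
      (use s in auto)
  define L where "L = (\<Sum>v\<in>V. (norm (w v))\<^sup>2 / (2 * s v))"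
  have L0: "0 \<le> L" unfolding L_def using s by (intro sum_nonneg) (simp add: less_imp_le)
  have RA: "inner x (R (A x)) \<le> L * (norm (C x))\<^sup>2 - \<gamma> * (norm x)\<^sup>2" for x
  proof -
    have "inner v (A x) * inner v x
        \<le> (norm (w v))\<^sup>2 / (2 * s v) * (norm (C x))\<^sup>2 - s v / 2 * (inner v x * inner v x)"
      if v: "v \<in> V" for v
    proof -
      let ?a = "inner v x" and ?b = "inner (w v) (C x)"
      have sv: "0 < s v" using s v by blast
      have "inner v (A x) = inner (adjoint A v) x"
        by (simp add: adjoint_works[OF A] inner_commute)
      also have "adjoint A v = - (s v *\<^sub>R v) - adjoint C (w v)"
        using w[rule_format, OF v] by (simp add: algebra_simps flip: w[rule_format, OF v])
      also have "inner \<dots> x = - (s v * ?a) - ?b"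
      proof -
        have "inner (adjoint C (w v)) x = ?b"
          by (subst (1 2) inner_commute) (rule adjoint_works[OF C])
        then show ?thesis by (simp add: inner_diff_left)
      qed
      finally have Av: "inner v (A x) = - (s v * ?a) - ?b" .
      have "?b\<^sup>2 \<le> (norm (w v))\<^sup>2 * (norm (C x))\<^sup>2"
        using Cauchy_Schwarz_ineq[of "w v" "C x"] by (simp add: power2_norm_eq_inner)
      then have "?b\<^sup>2 / (2 * s v) \<le> (norm (w v))\<^sup>2 / (2 * s v) * (norm (C x))\<^sup>2"
        using sv by (simp add: divide_right_mono)
      moreover have "0 \<le> (s v * ?a + ?b)\<^sup>2 / (2 * s v)" using sv by simp
      moreover have "(s v * ?a + ?b)\<^sup>2 / (2 * s v) = s v / 2 * (?a * ?a) + ?a * ?b + ?b\<^sup>2 / (2 * s v)"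
        using sv by (simp add: field_simps power2_eq_square)
      ultimately show ?thesis unfolding Av by (simp add: algebra_simps)
    qed
    then have "(\<Sum>v\<in>V. inner v (A x) * inner v x)
        \<le> (\<Sum>v\<in>V. (norm (w v))\<^sup>2 / (2 * s v) * (norm (C x))\<^sup>2 - s v / 2 * (inner v x * inner v x))"
      by (rule sum_mono)
    also have "\<dots> = L * (norm (C x))\<^sup>2 - inner x (\<Sum>v\<in>V. (s v / 2 * inner v x) *\<^sub>R v)"
    proof -
      have "inner x (\<Sum>v\<in>V. (s v / 2 * inner v x) *\<^sub>R v)
          = (\<Sum>v\<in>V. s v / 2 * (inner v x * inner v x))"
        by (simp add: inner_sum_right inner_commute[of x] mult_ac)
      then show ?thesis by (simp only: L_def sum_subtractf sum_distrib_right)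
    qed
    also have "\<dots> \<le> L * (norm (C x))\<^sup>2 - \<gamma> * (norm x)\<^sup>2" using \<gamma>(2) by simp
    also have "(\<Sum>v\<in>V. inner v (A x) * inner v x) = inner x (R (A x))"
      by (simp add: R_def inner_sum_right inner_commute[of x])
    finally show ?thesis .
  qed
  \<comment> \<open>\<open>L\<close> may be \<open>0\<close>, hence the \<open>1\<close>.\<close>
  define \<epsilon> where "\<epsilon> = \<kappa> / (L + 1)"
  have \<epsilon>: "0 < \<epsilon>" "\<epsilon> * L \<le> \<kappa>" using \<kappa> L0 by (simp_all add: \<epsilon>_def field_simps)
  show ?thesis
  proof (rule strict_Lyapunov_imp_exponentially_stable)
    show "linear (\<lambda>x. P x + \<epsilon> *\<^sub>R R x)"
      by (intro linear_compose_add P linear_compose_scale_right R)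
    show "inner x (P y + \<epsilon> *\<^sub>R R y) = inner (P x + \<epsilon> *\<^sub>R R x) y" for x y
      by (simp add: inner_add_left inner_add_right sym R(2))
    show "0 < inner x (P x + \<epsilon> *\<^sub>R R x)" if "x \<noteq> 0" for x
      using pos[OF that] R(3)[OF that] \<epsilon>(1) by (simp add: inner_add_right add_pos_pos)
    show "0 < \<epsilon> * \<gamma>" using \<epsilon>(1) \<gamma>(1) by simp
    show "inner x (P (A x) + \<epsilon> *\<^sub>R R (A x)) \<le> - (\<epsilon> * \<gamma>) * (norm x)\<^sup>2" for x
    proof -
      have "\<epsilon> * inner x (R (A x)) \<le> \<epsilon> * (L * (norm (C x))\<^sup>2 - \<gamma> * (norm x)\<^sup>2)"
        using \<epsilon>(1) RA by (intro mult_left_mono) simp_all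
      moreover have "(\<epsilon> * L) * (norm (C x))\<^sup>2 \<le> \<kappa> * (norm (C x))\<^sup>2"
        using \<epsilon>(2) by (rule mult_right_mono) simp
      ultimately show ?thesis using decr[of x] by (simp add: algebra_simps)
    qed
  qed
qed

text \<open>The curve \<open>cos (\<omega> t) x0 + sin (\<omega> t) / \<omega> f x0\<close> is a periodic solution.\<close>

lemma periodic_orbit_not_exponentially_stable:
  fixes f :: "'a::real_normed_vector \<Rightarrow> 'a"
  assumes f: "linear f" and \<omega>: "0 < \<omega>" and x0: "x0 \<noteq> 0" "f (f x0) = - (\<omega> * \<omega>) *\<^sub>R x0"
  shows "\<not> exponentially_stable f"
proof
  assume "exponentially_stable f"
  then obtain c a where c: "0 < c" and a: "0 < a"
    and stable: "\<And>x t. solves_ode f x \<Longrightarrow> 0 \<le> t \<Longrightarrow> norm (x t) \<le> c * exp (- a * t) * norm (x 0)"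
    unfolding exponentially_stable_def by blast
  define x where "x t = cos (\<omega> * t) *\<^sub>R x0 + (sin (\<omega> * t) / \<omega>) *\<^sub>R f x0" for t
  have "solves_ode f x"
    unfolding solves_ode_def
  proof (intro allI impI)
    fix t :: real
    have "f (x t) = (- sin (\<omega> * t) * \<omega>) *\<^sub>R x0 + cos (\<omega> * t) *\<^sub>R f x0"
      using \<omega> by (simp add: x_def linear_add[OF f] linear_scale[OF f] x0(2))
    moreover have "(x has_vector_derivative
        (- sin (\<omega> * t) * \<omega>) *\<^sub>R x0 + cos (\<omega> * t) *\<^sub>R f x0) (at t within {0..})"
      unfolding x_def[abs_def] using \<omega>
      by (auto intro!: derivative_eq_intros simp: has_vector_derivative_def fun_eq_iff
          scaleR_diff_right mult_ac)
    ultimately show "(x has_vector_derivative f (x t)) (at t within {0..})" by simp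
  qed
  note bound = stable[OF this]
  define r where "r = exp (- a * (2 * pi / \<omega>))"
  have "r < 1" using a \<omega> by (simp add: r_def)
  then obtain k where k: "r ^ k < 1 / c"
    using real_arch_pow_inv[of "1 / c" r] c by auto
  define t where "t = real k * (2 * pi / \<omega>)"
  have "\<omega> * t = 2 * pi * real k" using \<omega> by (simp add: t_def)
  then have "x t = x 0" using cos_2npi[of k] sin_2npi[of k] by (simp add: x_def mult_ac)
  moreover have "exp (- a * t) = r ^ k"
    by (simp add: r_def t_def exp_of_nat_mult[symmetric] mult_ac)
  moreover have "0 \<le> t" using \<omega> by (simp add: t_def)
  ultimately have "norm (x 0) \<le> c * r ^ k * norm (x 0)" using bound[of t] by simp
  moreover have "norm (x 0) > 0" using x0(1) by (simp add: x_def)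
  ultimately have "1 \<le> c * r ^ k" by simp
  with k c show False by (simp add: field_simps)
qed

context hamiltonian_system
begin

lemma linear_target_field: "linear (target_field M G Mh Sh Kd)"
proof (rule linearI)
  show "target_field M G Mh Sh Kd (x + y) = target_field M G Mh Sh Kd x + target_field M G Mh Sh Kd y"
    for x y
    by (cases x; cases y) (simp add: target_field_def matrix_vector_right_distrib)
  show "target_field M G Mh Sh Kd (c *\<^sub>R x) = c *\<^sub>R target_field M G Mh Sh Kd x" for c x
    by (cases x) (simp add: target_field_def matrix_vector_mult_scaleR scaleR_diff_right)
qed

lemma target_field_eq:
  "target_field M G Mh Sh Kd (q, p)
    = (matrix_inv M *v p, - (Mh *v (matrix_inv M *v (Sh *v q)))
        - G *v (Kd *v (transpose G *v (matrix_inv Mh *v p))))"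
  by (simp add: target_field_def matrix_vector_mul_assoc matrix_mul_assoc)

lemma inner_transpose_G: "inner w (transpose G *v r) = inner r (G *v w)"
  by (simp add: inner_commute[of w] dot_lmul_matrix)

text \<open>For a mode \<open>z\<close> in \<open>Z\<close> with eigenvalue \<open>l > 0\<close>, the coordinate
  \<open>\<phi> (q, p) = inner z (M *v q)\<close> satisfies \<open>\<phi>'' = - l \<phi>\<close> along the closed loop, as the feedback acts through the
  range of \<open>G\<close>. So \<open>\<phi>\<close> annihilates the range of \<open>f \<circ> f + l\<close>, where \<open>f\<close> is the closed loop;
  this map is then not injective either, and a vector in its kernel starts a periodic orbit.\<close>

lemma exponentially_stable_imp_controllable:
  assumes Mh: "pos_def Mh" and Sh: "pos_def Sh" and match: "matching Mh Sh"
    and stable: "exponentially_stable (target_field M G Mh Sh Kd)"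
  shows "controllable (drift M S) (input_map G)"
proof (rule ccontr)
  assume "\<not> ?thesis"
  then obtain z0 where z0: "z0 \<in> Z" "z0 \<noteq> 0" unfolding controllable_iff by blast
  obtain z l where z: "z \<in> Z" "z \<noteq> 0" "T z = l *\<^sub>R z"
    by (rule selfadjoint_least_eigenvector[OF M linear_T T_selfadjoint subspace_Z T_in_Z z0])
  have "0 < inner z (S *v z)"
    using matching_imp_positive_modes[OF Mh Sh match] z by (simp add: positive_modes_def)
  also have "\<dots> = l * inner z (M *v z)" by (simp add: mode_S[OF z(3)])
  finally have l: "0 < l" using pos_def_pos[OF M z(2)] by (simp add: zero_less_mult_iff)
  let ?f = "target_field M G Mh Sh Kd"
  define \<phi> where "\<phi> x = inner z (M *v fst x)" for x :: "(real^'n) \<times> (real^'n)"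
  have \<phi>: "\<phi> (?f (?f x)) = - l * \<phi> x" for x
  proof -
    obtain q p where x: "x = (q, p)" by (cases x)
    obtain w where w: "Mh *v (matrix_inv M *v (Sh *v q)) = S *v q + G *v w"
      using match unfolding matching_def by blast
    have "\<phi> (?f (?f x)) = - inner z (S *v q)"
      by (simp add: x \<phi>_def target_field_eq M w inner_diff_right inner_add_right
          Z_orthogonal_G[OF z(1)])
    also have "inner z (S *v q) = l * inner z (M *v q)"
      by (simp add: symmetric_inner[OF S] mode_S[OF z(3)] pos_def_inner[OF M])
    finally show ?thesis by (simp add: \<phi>_def x)
  qed
  have lin: "linear (\<lambda>x. ?f (?f x) + l *\<^sub>R x)"
    using linear_compose[OF linear_target_field linear_target_field]
    by (intro linear_compose_add linear_scaleR) (simp add: o_def)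
  have "\<not> surj (\<lambda>x. ?f (?f x) + l *\<^sub>R x)"
  proof
    assume "surj (\<lambda>x. ?f (?f x) + l *\<^sub>R x)"
    then obtain x where x: "(z, 0) = ?f (?f x) + l *\<^sub>R x" by (rule surjE)
    have "\<phi> (z, 0) = \<phi> (?f (?f x)) + l * \<phi> x"
      unfolding x by (simp add: \<phi>_def matrix_vector_right_distrib inner_add_right
          matrix_vector_mult_scaleR)
    also have "\<dots> = 0" by (simp add: \<phi>)
    finally show False using pos_def_pos[OF M z(2)] by (simp add: \<phi>_def)
  qed
  then have "\<not> inj (\<lambda>x. ?f (?f x) + l *\<^sub>R x)" using linear_inj_imp_surj[OF lin] by blast
  then obtain x0 where x0: "?f (?f x0) + l *\<^sub>R x0 = 0" "x0 \<noteq> 0"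
    unfolding linear_injective_0[OF lin] by blast
  have "?f (?f x0) = - (sqrt l * sqrt l) *\<^sub>R x0"
    using x0(1) l by (simp add: eq_neg_iff_add_eq_0)
  from periodic_orbit_not_exponentially_stable[OF linear_target_field _ x0(2) this] l stable
  show False by simp
qed

text \<open>The target Hamiltonian, half of the form of \<open>P\<close>, has the derivative
  \<open>- inner (C x) (Kd *v C x)\<close> along the closed loop, with the output \<open>C x = transpose G *v (matrix_inv Mh *v p)\<close>. For observability let \<open>N\<close> be an
  invariant subspace on which \<open>C\<close> vanishes. The matching equation shows that the vectors
  \<open>r = matrix_inv Mh *v p\<close>, with \<open>(q, p)\<close> in \<open>N\<close>, form a \<open>T\<close>-invariant set annihilated by
  the transpose of \<open>G\<close>, that is, a subset of \<open>Z\<close>, which is trivial. So \<open>p = 0\<close> on \<open>N\<close>, and by invariance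
  the force \<open>Mh *v (matrix_inv M *v (Sh *v q))\<close> vanishes, which leaves \<open>q = 0\<close>.\<close>

lemma controllable_imp_exponentially_stable:
  assumes Mh: "pos_def Mh" and Sh: "pos_def Sh" and Kd: "pos_def Kd" and match: "matching Mh Sh"
    and ctrl: "controllable (drift M S) (input_map G)"
  shows "exponentially_stable (target_field M G Mh Sh Kd)"
proof -
  let ?f = "target_field M G Mh Sh Kd"
  define C where "C x = transpose G *v (matrix_inv Mh *v snd x)" for x :: "(real^'n) \<times> (real^'n)"
  define P where "P x = (Sh *v fst x, matrix_inv Mh *v snd x)" for x :: "(real^'n) \<times> (real^'n)"
  note Mh' = pos_def_matrix_inv[OF Mh]
  obtain \<kappa> where \<kappa>: "0 < \<kappa>" "\<forall>y. \<kappa> * (norm y)\<^sup>2 \<le> inner y (Kd *v y)"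
    by (rule positive_form_coercive[OF matrix_vector_mul_linear pos_def_pos[OF Kd]])
  show ?thesis
  proof (rule observable_Lyapunov_imp_exponentially_stable)
    show "linear ?f" by (rule linear_target_field)
    show "linear C"
      by (rule linearI) (simp_all add: C_def matrix_vector_right_distrib matrix_vector_mult_scaleR)
    show "linear P"
      by (rule linearI) (simp_all add: P_def matrix_vector_right_distrib matrix_vector_mult_scaleR)
    show "inner x (P y) = inner (P x) y" for x y
      by (simp add: P_def inner_prod_def pos_def_inner[OF Sh] pos_def_inner[OF Mh'])
    show "0 < inner x (P x)" if "x \<noteq> 0" for x
    proof (cases "fst x = 0")
      case True
      then have "snd x \<noteq> 0" using that by (simp add: prod_eq_iff)
      then show ?thesis using True by (simp add: P_def inner_prod_def pos_def_pos[OF Mh'])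
    next
      case False
      then show ?thesis
        using pos_def_pos[OF Sh False] pos_def_nonneg[OF Mh', of "snd x"]
        by (simp add: P_def inner_prod_def)
    qed
    show "0 < \<kappa>" by (rule \<kappa>)
    show "inner x (P (?f x)) \<le> - \<kappa> * (norm (C x))\<^sup>2" for x
    proof -
      obtain q p where x: "x = (q, p)" by (cases x)
      let ?r = "matrix_inv Mh *v p"
      have r: "inner p (matrix_inv Mh *v y) = inner ?r y" for y
        by (simp only: pos_def_inner[OF Mh'])
      have "inner ?r (Mh *v (matrix_inv M *v (Sh *v q))) = inner q (Sh *v (matrix_inv M *v p))"
      proof -
        have "inner ?r (Mh *v (matrix_inv M *v (Sh *v q))) = inner p (matrix_inv M *v (Sh *v q))"
          by (simp add: pos_def_inner[OF Mh] Mh)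
        also have "\<dots> = inner (matrix_inv M *v p) (Sh *v q)"
          by (rule pos_def_inner[OF pos_def_matrix_inv[OF M]])
        also have "\<dots> = inner q (Sh *v (matrix_inv M *v p))"
          by (subst pos_def_inner[OF Sh]) (rule inner_commute)
        finally show ?thesis .
      qed
      moreover have "inner ?r (G *v (Kd *v C x)) = inner (C x) (Kd *v C x)"
        by (simp add: C_def x inner_transpose_G[symmetric] inner_commute)
      ultimately have "inner x (P (?f x)) = - inner (C x) (Kd *v C x)"
        by (simp add: x P_def inner_prod_def target_field_eq r inner_diff_right C_def)
      then show ?thesis using \<kappa>(2)[rule_format, of "C x"] by simp
    qed
    show "x = 0" if N: "subspace N" "\<And>y. y \<in> N \<Longrightarrow> ?f y \<in> N" "\<And>y. y \<in> N \<Longrightarrow> C y = 0"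
      and x: "x \<in> N" for N x
    proof -
      have step: "(matrix_inv M *v p, - (Mh *v (matrix_inv M *v (Sh *v q)))) \<in> N"
        if "(q, p) \<in> N" for q p
        using N(2)[OF that] N(3)[OF that]
        by (simp add: target_field_eq C_def)
      define U where "U = (\<lambda>y. matrix_inv Mh *v snd y) ` N"
      have GU: "inner r (G *v w) = 0" if "r \<in> U" for r w
        using that N(3) unfolding U_def C_def by (auto simp flip: inner_transpose_G)
      have TU: "T r \<in> U" if rU: "r \<in> U" for r
      proof -
        obtain q p where qp: "(q, p) \<in> N" and r: "r = matrix_inv Mh *v p"
          using rU by (auto simp: U_def)
        \<comment> \<open>Pair the matching equation at \<open>y\<close> with \<open>r\<close>; the term in \<open>G\<close> drops out.\<close>
        have "S *v r = Sh *v (matrix_inv M *v p)"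
        proof (rule vector_eq_rdot[THEN iffD1], rule allI)
          fix y
          obtain w where w: "Mh *v (matrix_inv M *v (Sh *v y)) = S *v y + G *v w"
            using match unfolding matching_def by blast
          have "inner (S *v r) y = inner r (S *v y + G *v w)"
            by (simp add: inner_add_right GU[OF rU] symmetric_inner[OF S])
          also have "\<dots> = inner (Sh *v (matrix_inv M *v p)) y"
            unfolding w[symmetric] r
            by (simp add: pos_def_inner[OF Mh] Mh pos_def_inner[OF Sh]
                pos_def_inner[OF pos_def_matrix_inv[OF M]])
          finally show "inner (S *v r) y = inner (Sh *v (matrix_inv M *v p)) y" .
        qed
        \<comment> \<open>Minus the second derivative of the state \<open>(q, p)\<close> along the flow has the momentum part \<open>Mh *v T r\<close>.\<close>
        then have "T r = matrix_inv Mh *v snd (- (- (matrix_inv M *v (Mh *v (matrix_inv M *v (Sh *v q)))),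
            - (Mh *v (matrix_inv M *v (Sh *v (matrix_inv M *v p))))))"
          by (simp add: T_def Mh)
        moreover have "- (- (matrix_inv M *v (Mh *v (matrix_inv M *v (Sh *v q)))),
            - (Mh *v (matrix_inv M *v (Sh *v (matrix_inv M *v p))))) \<in> N"
          using subspace_neg[OF N(1) step[OF step[OF qp]]]
          by (simp add: linear_neg[OF matrix_vector_mul_linear])
        ultimately show ?thesis unfolding U_def by (rule image_eqI)
      qed
      have p0: "p = 0" if "(q, p) \<in> N" for q p
      proof -
        have "matrix_inv Mh *v p \<in> U" using that unfolding U_def by force
        then have "matrix_inv Mh *v p \<in> Z" by (intro orthogonal_imp_in_Z[where U = U] TU GU)
        then have "matrix_inv Mh *v p = 0" using ctrl unfolding controllable_iff by blast
        then show ?thesis using pos_def_inv_cancel(1)[OF Mh, of p] by simp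
      qed
      obtain q p where qp: "x = (q, p)" by (cases x)
      have "Mh *v (matrix_inv M *v (Sh *v q)) = 0" using p0[OF step] x qp by auto
      then have "matrix_inv M *v (Sh *v q) = 0" using pos_def_inv_cancel(2)[OF Mh] by (metis matrix_vector_mult_0_right)
      then have "Sh *v q = 0" using pos_def_inv_cancel(1)[OF M] by (metis matrix_vector_mult_0_right)
      then have "q = 0" using pos_def_eq_0_iff[OF Sh, of q] by simp
      then show ?thesis using p0 x qp by (simp add: zero_prod_def)
    qed
  qed
qed

end

theorem theorem1:
  fixes M S :: "real^'n^'n" and G :: "real^'m^'n"
  assumes "CARD('m) \<le> CARD('n)"
    and "pos_def M"
    and "transpose S = S"
    and "rank G = CARD('m)"
  shows "((\<exists>Mh Sh Kd. pos_def Mh \<and> pos_def Sh \<and> pos_def Kd \<and>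
             (\<exists>u. feedback_transforms M S G u (target_field M G Mh Sh Kd)))
          \<longleftrightarrow> controllable (drift M S) (input_map G) \<or>
              (\<exists>C. uncontrollable_part (drift M S) (input_map G) C \<and> oscillatory C))
       \<and> (\<forall>Mh Sh Kd u.
             pos_def Mh \<longrightarrow> pos_def Sh \<longrightarrow> pos_def Kd \<longrightarrow>
             feedback_transforms M S G u (target_field M G Mh Sh Kd) \<longrightarrow>
             (exponentially_stable (target_field M G Mh Sh Kd)
              \<longleftrightarrow> controllable (drift M S) (input_map G)))"
proof -
  interpret hamiltonian_system M S G by unfold_locales (fact assms)+
  have one: "pos_def (Finite_Cartesian_Product.mat 1 :: real^'m^'m)"
    by (simp add: pos_def_def)
  have "(\<exists>Mh Sh Kd. pos_def Mh \<and> pos_def Sh \<and> pos_def Kd \<and>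
        (\<exists>u. feedback_transforms M S G u (target_field M G Mh Sh Kd))) \<longleftrightarrow> positive_modes"
  proof
    assume "\<exists>Mh Sh Kd. pos_def Mh \<and> pos_def Sh \<and> pos_def Kd \<and>
        (\<exists>u. feedback_transforms M S G u (target_field M G Mh Sh Kd))"
    then show positive_modes using feedback_imp_matching matching_imp_positive_modes by blast
  next
    assume positive_modes
    then obtain Mh Sh where h: "pos_def Mh" "pos_def Sh" "matching Mh Sh"
      by (rule positive_modes_imp_matching)
    obtain u where "feedback_transforms M S G u
        (target_field M G Mh Sh (Finite_Cartesian_Product.mat 1 :: real^'m^'m))"
      by (rule matching_imp_feedback[OF h(3)])
    with h one show "\<exists>Mh Sh Kd. pos_def Mh \<and> pos_def Sh \<and> pos_def Kd \<and>
        (\<exists>u. feedback_transforms M S G u (target_field M G Mh Sh Kd))" by blast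
  qed
  moreover have "positive_modes \<longleftrightarrow> controllable (drift M S) (input_map G) \<or>
      (\<exists>C. uncontrollable_part (drift M S) (input_map G) C \<and> oscillatory C)"
    using controllable_imp_positive_modes oscillatory_imp_positive_modes
      positive_modes_imp_oscillatory by metis
  moreover have "exponentially_stable (target_field M G Mh Sh Kd)
      \<longleftrightarrow> controllable (drift M S) (input_map G)"
    if "pos_def Mh" "pos_def Sh" "pos_def Kd"
      "feedback_transforms M S G u (target_field M G Mh Sh Kd)" for Mh Sh Kd u
    using that exponentially_stable_imp_controllable controllable_imp_exponentially_stable
      feedback_imp_matching by blast
  ultimately show ?thesis by blast
qed

end
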